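(* The map $(\alpha,g,s)\mapsto(\alpha^*,g^*,s^* )$ is a weak regular involution on the category $\overline{2\mathfrak{Cob}}$.
   Context: Weak regular involution: a unary operation ${}^*$ on the arrows of a category, taking each arrow $\alpha:a\to b$ to an arrow $\alpha^*:b\to a$, such that $\alpha\alpha^*\alpha=\alpha$ and $(\alpha^* )^*=\alpha$ for all arrows $\alpha$ (arrows are composed from left to right). Notation: $[n]=\{1,\dots,n\}$. A partition $\alpha:[m]\leadsto[n]$ is a set partition of $[m]\sqcup[n]$; elements of $[m]$ are incoming, those of $[n]$ outgoing vertices. For $\alpha:[\ell]\leadsto[m]$ and $\beta:[m]\leadsto[n]$, let $(\alpha\cup\beta)^t$ be the partition of $[\ell]\sqcup[m]\sqcup[n]$ generated by $\alpha$ (on the first two components) and $\beta$ (on the last two); $\alpha\beta$ is its restriction to $[\ell]\sqcup[n]$. A dead block is a block of $(\alpha\cup\beta)^t$ contained in the middle component. The category $\overline{2\mathfrak{Cob}}$: objects are the elements of $\mathbb N_0$; arrows $m\to n$ are all triples $(\alpha,g,s)$ with $\alpha:[m]\leadsto[n]$ a partition, $g$ a function from the blocks of $\alpha$ to $\mathbb Z$, $s\in\bigoplus_{i\in\mathbb Z}\mathbb Z$. Composition: $(\alpha,g,s)(\beta,h,t)=(\alpha\beta,\mathbf g,s+t+\mathbf b)$, where a block $C$ of $(\alpha\cup\beta)^t$ that is the union of blocks $A_1,\dots,A_a$ of $\alpha$ and $B_1,\dots,B_b$ of $\beta$ and contains exactly $v$ elements of the middle component has label $\mathbf g(C)=\sum_i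 g(A_i)+\sum_j h(B_j)+v-(a+b)+1$; the label of a block of $\alpha\beta$ is that of the block of $(\alpha\cup\beta)^t$ containing it; $\mathbf b=(b_i)_{i\in\mathbb Z}$ with $b_i$ the number of dead blocks of label $i$. The unary operation: for $(\alpha,g,s):m\to n$, $\alpha^*:[n]\leadsto[m]$ is the same partition as $\alpha$ with incoming and outgoing vertices swapped. For a block $C$ of $\alpha$ let $C^*$ be the corresponding block of $\alpha^*$; then $g^*(C^* )=-g(C)-\mathrm v(C)+2$, where $\mathrm v(C)$ is the number of vertices of $C$. Finally $s^*=(\dots,-s_{-1},-s_0,-s_1-\mathrm{ub}(\alpha)-\mathrm{lb}(\alpha),-s_2,\dots)$, i.e. $s^*_i=-s_i$ for $i\ne1$ and $s^*_1=-s_1-\mathrm{ub}(\alpha)-\mathrm{lb}(\alpha)$, where $\mathrm{ub}(\alpha)$ is the number of blocks of $\alpha$ containing only incoming vertices and $\mathrm{lb}(\alpha)$ the number of blocks containing only outgoing vertices. *)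

theory Defs
  imports Main "HOL-Library.Disjoint_Sets" "HOL-Library.FuncSet" "HOL-Library.Poly_Mapping"
begin

text \<open>Categories whose objects are the elements of the type \<open>'o\<close>; composition is written from left to
  right and is only constrained on composable arrows.\<close>

locale category =
  fixes hom :: "'o \<Rightarrow> 'o \<Rightarrow> 'a set"
    and comp :: "'a \<Rightarrow> 'a \<Rightarrow> 'a"  (infixl "\<cdot>" 70)
  assumes hom_unique: "\<lbrakk>f \<in> hom a b; f \<in> hom a' b'\<rbrakk> \<Longrightarrow> a = a' \<and> b = b'"
    and comp_in_hom: "\<lbrakk>f \<in> hom a b; g \<in> hom b c\<rbrakk> \<Longrightarrow> f \<cdot> g \<in> hom a c"
    and comp_assoc: "\<lbrakk>f \<in> hom a b; g \<in> hom b c; h \<in> hom c d\<rbrakk> \<Longrightarrow> (f \<cdot> g) \<cdot> h = f \<cdot> (g \<cdot> h)"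
    and identity: "\<exists>e \<in> hom a a. (\<forall>b. \<forall>f \<in> hom a b. e \<cdot> f = f) \<and> (\<forall>b. \<forall>f \<in> hom b a. f \<cdot> e = f)"

locale weak_regular_involution = category +
  fixes star :: "'b \<Rightarrow> 'b"
  assumes star_in_hom: "f \<in> hom a b \<Longrightarrow> star f \<in> hom b a"
    and star_regular: "f \<in> hom a b \<Longrightarrow> f \<cdot> star f \<cdot> f = f"
    and star_star: "f \<in> hom a b \<Longrightarrow> star (star f) = f"


text \<open>A partition \<open>[m] \<leadsto> [n]\<close> is given by its set of blocks: \<open>Inl i\<close> is the incoming vertex \<open>i\<close>,
  \<open>Inr j\<close> the outgoing vertex \<open>j\<close>.\<close>

type_synonym vertex = "nat + nat"

definition partitions :: "nat \<Rightarrow> nat \<Rightarrow> vertex set set set" where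
  "partitions m n = {\<alpha>. partition_on ({1..m} <+> {1..n}) \<alpha>}"

text \<open>The vertices of \<open>(\<alpha> \<union> \<beta>)\<^sup>t\<close> live in \<open>[\<ell>] \<squnion> [m] \<squnion> [n]\<close>, with \<open>Inl i\<close>, \<open>Inr (Inl j)\<close> and
  \<open>Inr (Inr k)\<close> in the first, middle and last component.\<close>

type_synonym vertex3 = "nat + nat + nat"

definition emb12 :: "vertex \<Rightarrow> vertex3" where "emb12 = map_sum id Inl"
definition emb23 :: "vertex \<Rightarrow> vertex3" where "emb23 = Inr"
definition emb13 :: "vertex \<Rightarrow> vertex3" where "emb13 = map_sum id Inr"

definition middle :: "vertex3 set" where
  "middle = range (\<lambda>j. Inr (Inl j))"

definition generated_partition :: "'a set set \<Rightarrow> 'a set set" where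
  "generated_partition F = \<Union>F // {(x, y). \<exists>A\<in>F. x \<in> A \<and> y \<in> A}\<^sup>+"

definition join :: "vertex set set \<Rightarrow> vertex set set \<Rightarrow> vertex3 set set" where
  "join \<alpha> \<beta> = generated_partition ((\<lambda>A. emb12 ` A) ` \<alpha> \<union> (\<lambda>B. emb23 ` B) ` \<beta>)"

definition partition_comp :: "vertex set set \<Rightarrow> vertex set set \<Rightarrow> vertex set set" where
  "partition_comp \<alpha> \<beta> = (\<lambda>C. emb13 -` C) ` join \<alpha> \<beta> - {{}}"

definition dead_blocks :: "vertex set set \<Rightarrow> vertex set set \<Rightarrow> vertex3 set set" where
  "dead_blocks \<alpha> \<beta> = {C \<in> join \<alpha> \<beta>. C \<subseteq> middle}"


text \<open>Block labellings are extensional functions (equal to \<open>undefined\<close> off the blocks), so that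
  equality of triples is equality of arrows.\<close>

type_synonym cob = "vertex set set \<times> (vertex set \<Rightarrow> int) \<times> (int \<Rightarrow>\<^sub>0 int)"

definition cob_hom :: "nat \<Rightarrow> nat \<Rightarrow> cob set" where
  "cob_hom m n = {(\<alpha>, g, s). \<alpha> \<in> partitions m n \<and> g \<in> \<alpha> \<rightarrow>\<^sub>E UNIV}"

definition join_label ::
  "vertex set set \<Rightarrow> (vertex set \<Rightarrow> int) \<Rightarrow> vertex set set \<Rightarrow> (vertex set \<Rightarrow> int) \<Rightarrow> vertex3 set \<Rightarrow> int"
  where
  "join_label \<alpha> g \<beta> h C =
    (let As = {A \<in> \<alpha>. emb12 ` A \<subseteq> C}; Bs = {B \<in> \<beta>. emb23 ` B \<subseteq> C}
     in (\<Sum>A\<in>As. g A) + (\<Sum>B\<in>Bs. h B) + int (card (C \<inter> middle)) - int (card As + card Bs) + 1)"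

definition cob_comp :: "cob \<Rightarrow> cob \<Rightarrow> cob" where
  "cob_comp = (\<lambda>(\<alpha>, g, s) (\<beta>, h, t).
    (partition_comp \<alpha> \<beta>,
     (\<lambda>X \<in> partition_comp \<alpha> \<beta>. join_label \<alpha> g \<beta> h (THE C. C \<in> join \<alpha> \<beta> \<and> emb13 ` X \<subseteq> C)),
     s + t + Abs_poly_mapping (\<lambda>i. int (card {D \<in> dead_blocks \<alpha> \<beta>. join_label \<alpha> g \<beta> h D = i}))))"


definition flip :: "vertex \<Rightarrow> vertex" where
  "flip = case_sum Inr Inl"

definition partition_star :: "vertex set set \<Rightarrow> vertex set set" where
  "partition_star \<alpha> = (\<lambda>C. flip ` C) ` \<alpha>"

definition ub :: "vertex set set \<Rightarrow> nat" where
  "ub \<alpha> = card {C \<in> \<alpha>. C \<subseteq> range Inl}"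

definition lb :: "vertex set set \<Rightarrow> nat" where
  "lb \<alpha> = card {C \<in> \<alpha>. C \<subseteq> range Inr}"

text \<open>Since \<open>flip\<close> is an involution, the block of \<open>\<alpha>\<close> corresponding to the block \<open>X\<close> of
  \<open>partition_star \<alpha>\<close> is \<open>flip ` X\<close>.\<close>

definition cob_star :: "cob \<Rightarrow> cob" where
  "cob_star = (\<lambda>(\<alpha>, g, s).
    (partition_star \<alpha>,
     (\<lambda>X \<in> partition_star \<alpha>. let C = flip ` X in - g C - int (card C) + 2),
     Poly_Mapping.update 1 (- Poly_Mapping.lookup s 1 - int (ub \<alpha>) - int (lb \<alpha>)) (- s)))"

end

theory Submission
  imports Defs
begin

text \<open>
  The label convention becomes transparent after subtracting \<open>1\<close>. If \<open>C\<close> is a block of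
  \<open>(\<alpha> \<union> \<beta>)\<^sup>t\<close>, then \<open>g(C) - 1\<close> is the sum of \<open>g(A) - 1\<close> over all blocks \<open>A\<close> of \<open>\<alpha>\<close> and \<open>\<beta>\<close> that were
  glued into \<open>C\<close>, plus the number of middle vertices in \<open>C\<close>: an additive quantity, playing the role of an
  Euler characteristic. Each law about composition compares two ways of gluing the same pieces and
  comes down to equality of the glued blocks, additivity of the weights, and a bijection between
  dead blocks.

  All vertex sets are therefore moved into one universe, where a partition is just a family of
  pieces with integer weights. There \<open>generated_partition F\<close> is characterised as the set of minimal
  nonempty saturated sets. Suppose that \<open>F\<close> and \<open>G\<close> are glued along a vertex set \<open>M\<close> that avoids the pieces
  of \<open>H\<close>. The blocks of \<open>F \<union> G \<union> H\<close> contained in \<open>M\<close> are exactly the dead blocks of \<open>F \<union> G\<close>; removing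
  \<open>M\<close> from the remaining ones is a bijection onto the blocks of the two-step gluing
  (\<open>live_block_trace_bij\<close>), and it preserves weights (\<open>weight_live_block\<close>). So gluing in two steps
  or all at once gives the same outcome, and this outcome is recorded by the predicate \<open>presents\<close>.
  An arrow is determined by any of its presentations along an injection (\<open>presents_unique\<close>).

  For associativity, both bracketings are presented by the gluing of all three partitions in the
  disjoint union of four copies of the natural numbers. The identity on \<open>m\<close> consists of \<open>m\<close> cylinders of
  weight \<open>-1\<close>, each of which contributes one middle vertex; gluing it on only renames vertices. For
  regularity, the blocks of the triple gluing of \<open>\<alpha>\<close>, \<open>\<alpha>\<^sup>*\<close>, \<open>\<alpha>\<close> are found explicitly: a block
  \<open>A\<close> of \<open>\<alpha>\<close> gives one block of the composite with label \<open>g(A)\<close>, and, exactly if \<open>A\<close> has only incoming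
  or only outgoing vertices, also one dead block of label \<open>1\<close>. The correction of the coefficient of index \<open>1\<close> in
  \<open>s\<^sup>*\<close> cancels these \<open>ub(\<alpha>) + lb(\<alpha>)\<close> dead blocks.
\<close>

section \<open>Partitions generated by set systems\<close>

lemma image_filter: "{y \<in> f ` S. R y} = f ` {x \<in> S. R (f x)}"
  by blast

definition saturated :: "'a set set \<Rightarrow> 'a set \<Rightarrow> bool" where
  "saturated F X \<longleftrightarrow> (\<forall>A\<in>F. A \<subseteq> X \<or> A \<inter> X = {})"

lemma saturated_Int: "saturated F X \<Longrightarrow> saturated F Y \<Longrightarrow> saturated F (X \<inter> Y)"
  unfolding saturated_def by blast

lemma saturated_Un_iff: "saturated (F \<union> G) X \<longleftrightarrow> saturated F X \<and> saturated G X"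
  unfolding saturated_def by blast

text \<open>Being the class of a transitive closure is traded for a condition that mentions only pieces
  and sets: the equivalence classes are the minimal nonempty saturated subsets of \<open>\<Union>F\<close>. A block
  is then confined to a set \<open>X\<close> that it meets by checking that \<open>X\<close> is saturated.\<close>

lemma generated_partition_iff:
  "C \<in> generated_partition F \<longleftrightarrow>
    C \<noteq> {} \<and> C \<subseteq> \<Union>F \<and> saturated F C \<and> (\<forall>X. saturated F X \<longrightarrow> X \<inter> C \<noteq> {} \<longrightarrow> C \<subseteq> X)"
    (is "_ \<longleftrightarrow> ?min C")
proof -
  define R where "R = {(x, y). \<exists>A\<in>F. x \<in> A \<and> y \<in> A}"
  have gen: "generated_partition F = \<Union>F // R\<^sup>+"
    by (simp add: generated_partition_def R_def)
  have inX: "x \<in> X \<longleftrightarrow> y \<in> X" if "(x, y) \<in> R\<^sup>+" "saturated F X" for x y X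
    using that(1) by induction (use that(2) in \<open>unfold R_def saturated_def, blast+\<close>)
  have inF: "y \<in> \<Union>F" if "(x, y) \<in> R\<^sup>+" for x y
    using that by cases (auto simp: R_def)
  have class_min: "?min (R\<^sup>+ `` {x})" if "x \<in> \<Union>F" for x
  proof (intro conjI allI impI)
    have "(x, x) \<in> R" using that by (auto simp: R_def)
    then show "R\<^sup>+ `` {x} \<noteq> {}" by blast
    show "R\<^sup>+ `` {x} \<subseteq> \<Union>F" using inF by blast
    show "saturated F (R\<^sup>+ `` {x})"
      unfolding saturated_def
    proof
      fix A assume "A \<in> F"
      then have "z \<in> R\<^sup>+ `` {x}" if "y \<in> A" "y \<in> R\<^sup>+ `` {x}" "z \<in> A" for y z
        using that by (auto simp: R_def intro: trancl_into_trancl)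
      then show "A \<subseteq> R\<^sup>+ `` {x} \<or> A \<inter> R\<^sup>+ `` {x} = {}" by blast
    qed
    show "R\<^sup>+ `` {x} \<subseteq> X" if "saturated F X" "X \<inter> R\<^sup>+ `` {x} \<noteq> {}" for X
      using that inX by blast
  qed
  show ?thesis
  proof
    assume "C \<in> generated_partition F"
    then obtain x where "x \<in> \<Union>F" "C = R\<^sup>+ `` {x}" unfolding gen by (rule quotientE)
    then show "?min C" using class_min by blast
  next
    assume C: "?min C"
    then obtain x where x: "x \<in> C" "x \<in> \<Union>F" by blast
    have "(x, x) \<in> R\<^sup>+" using x by (auto simp: R_def)
    with x have "C \<inter> R\<^sup>+ `` {x} \<noteq> {}" by blast
    with C class_min[OF x(2)] have "C = R\<^sup>+ `` {x}" by (metis Int_commute subset_antisym)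
    then show "C \<in> generated_partition F" using x(2) unfolding gen by (auto intro: quotientI)
  qed
qed

lemma generated_partition_eq_if_meet:
  "\<lbrakk>C \<in> generated_partition F; D \<in> generated_partition F; C \<inter> D \<noteq> {}\<rbrakk> \<Longrightarrow> C = D"
  unfolding generated_partition_iff by (metis Int_commute subset_antisym)

lemma generated_partition_saturated: "C \<in> generated_partition F \<Longrightarrow> saturated F C"
  by (simp add: generated_partition_iff)

lemma generated_partition_minimal:
  "\<lbrakk>C \<in> generated_partition F; saturated F X; X \<inter> C \<noteq> {}\<rbrakk> \<Longrightarrow> C \<subseteq> X"
  by (simp add: generated_partition_iff)

lemma Union_generated_partition: "\<Union>(generated_partition F) = \<Union>F"
proof
  show "\<Union>(generated_partition F) \<subseteq> \<Union>F"
  proof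
    fix x assume "x \<in> \<Union>(generated_partition F)"
    then obtain C where "C \<in> generated_partition F" "x \<in> C" by blast
    then show "x \<in> \<Union>F" unfolding generated_partition_iff by blast
  qed
  show "\<Union>F \<subseteq> \<Union>(generated_partition F)"
    unfolding generated_partition_def
    by (fastforce simp: quotient_def)
qed

lemma generated_partition_above:
  assumes "A \<in> F" "A \<noteq> {}"
  obtains C where "C \<in> generated_partition F" "A \<subseteq> C"
proof -
  obtain x where "x \<in> A" using assms by blast
  then obtain C where C: "C \<in> generated_partition F" "x \<in> C"
    using assms(1) Union_generated_partition[of F] by blast
  with \<open>x \<in> A\<close> assms(1) have "A \<subseteq> C"
    using generated_partition_saturated[OF C(1)] unfolding saturated_def by blast
  with C show thesis using that by blast
qed

lemma partition_on_generated_partition: "partition_on (\<Union>F) (generated_partition F)"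
proof (rule partition_onI)
  show "\<Union>(generated_partition F) = \<Union>F" by (rule Union_generated_partition)
  show "disjnt C D" if "C \<in> generated_partition F" "D \<in> generated_partition F" "C \<noteq> D" for C D
    using generated_partition_eq_if_meet that unfolding disjnt_def by blast
  show "{} \<notin> generated_partition F" by (simp add: generated_partition_iff)
qed

text \<open>Blocks are disjoint, so a set of blocks that covers \<open>\<Union>F\<close> leaves no room for another one.\<close>

lemma generated_partition_eqI:
  assumes "P \<subseteq> generated_partition F" "\<Union>F \<subseteq> \<Union>P"
  shows "generated_partition F = P"
proof
  show "generated_partition F \<subseteq> P"
  proof
    fix C assume C: "C \<in> generated_partition F"
    then obtain x where x: "x \<in> C" "x \<in> \<Union>F" unfolding generated_partition_iff by blast
    then obtain D where "D \<in> P" "x \<in> D" using assms by blast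
    with x assms C have "C = D" by (metis IntI emptyE generated_partition_eq_if_meet subsetD)
    with \<open>D \<in> P\<close> show "C \<in> P" by simp
  qed
qed (fact assms(1))

lemma finite_generated_partition:
  assumes "finite F" "\<And>A. A \<in> F \<Longrightarrow> finite A"
  shows "finite (generated_partition F)" "\<And>C. C \<in> generated_partition F \<Longrightarrow> finite C"
proof -
  have fin: "finite (\<Union>F)" using assms by (rule finite_Union)
  then show "finite (generated_partition F)"
    using partition_on_generated_partition by (rule finite_elements)
  show "finite C" if "C \<in> generated_partition F" for C
    using that fin by (metis generated_partition_iff finite_subset)
qed

lemma saturated_image_iff:
  assumes "inj e" shows "saturated (image e ` F) (e ` X) \<longleftrightarrow> saturated F X"
proof -
  have "e ` A \<subseteq> e ` X \<longleftrightarrow> A \<subseteq> X" "e ` A \<inter> e ` X = {} \<longleftrightarrow> A \<inter> X = {}" for A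
    using assms by (auto dest: injD)
  then show ?thesis unfolding saturated_def by simp
qed

lemma generated_partition_image:
  assumes "inj e"
  shows "generated_partition (image e ` F) = image e ` generated_partition F"
proof (rule generated_partition_eqI)
  show "\<Union> (image e ` F) \<subseteq> \<Union> (image e ` generated_partition F)"
    using Union_generated_partition[of F] by (metis image_Union order_refl)
  show "image e ` generated_partition F \<subseteq> generated_partition (image e ` F)"
  proof
    fix D assume "D \<in> image e ` generated_partition F"
    then obtain C where C: "C \<in> generated_partition F" and D: "D = e ` C" by blast
    show "D \<in> generated_partition (image e ` F)"
      unfolding generated_partition_iff
    proof (intro conjI allI impI)
      have "C \<noteq> {}" "C \<subseteq> \<Union>F" using C by (simp_all add: generated_partition_iff)
      then show "D \<noteq> {}" "D \<subseteq> \<Union> (image e ` F)" unfolding D by blast+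
      show "saturated (image e ` F) D"
        using C assms by (simp add: D saturated_image_iff generated_partition_saturated)
      fix X assume X: "saturated (image e ` F) X" "X \<inter> D \<noteq> {}"
      have "saturated F (e -` X)" "e -` X \<inter> C \<noteq> {}"
        using X by (auto simp: saturated_def D)
      then have "C \<subseteq> e -` X" using C by (rule generated_partition_minimal[rotated])
      then show "D \<subseteq> X" by (auto simp: D)
    qed
  qed
qed

section \<open>Removing interior vertices\<close>

text \<open>The blocks of a gluing as seen from outside, once the vertices in \<open>M\<close> have become interior; the
  dead blocks disappear.\<close>

definition trace :: "'a set \<Rightarrow> 'a set set \<Rightarrow> 'a set set" where
  "trace M P = (\<lambda>C. C - M) ` P - {{}}"

text \<open>No piece of \<open>G\<close> touches a subset of \<open>M\<close>, so \<open>G\<close> can neither enlarge a block lying in \<open>M\<close> nor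
  split it.\<close>

lemma dead_block_iff:
  assumes "M \<inter> \<Union>G = {}" "D \<subseteq> M"
  shows "D \<in> generated_partition (F \<union> G) \<longleftrightarrow> D \<in> generated_partition F"
proof
  assume D: "D \<in> generated_partition (F \<union> G)"
  show "D \<in> generated_partition F"
    unfolding generated_partition_iff
  proof (intro conjI allI impI)
    show "D \<noteq> {}" "D \<subseteq> \<Union>F" "saturated F D"
      using D assms by (auto simp: generated_partition_iff saturated_Un_iff)
    fix X assume X: "saturated F X" "X \<inter> D \<noteq> {}"
    have "saturated G (X \<inter> D)" using assms by (auto simp: saturated_def)
    with X(1) \<open>saturated F D\<close> have "saturated (F \<union> G) (X \<inter> D)"
      by (simp add: saturated_Int saturated_Un_iff)
    with generated_partition_minimal[OF D this] X(2) show "D \<subseteq> X" by blast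
  qed
next
  assume D: "D \<in> generated_partition F"
  have "saturated G D" using assms by (auto simp: saturated_def)
  moreover have "D \<subseteq> \<Union>(F \<union> G)" using D unfolding generated_partition_iff by blast
  ultimately show "D \<in> generated_partition (F \<union> G)"
    using D by (simp add: generated_partition_iff saturated_Un_iff)
qed

text \<open>Saturation of \<open>C - M\<close> is inherited from \<open>C\<close>. For minimality, a saturated set \<open>X\<close> of the second
  gluing is thickened to a set \<open>Y\<close> that is saturated for \<open>F \<union> G\<close>, by adding the \<open>F\<close>-blocks whose trace
  lies in \<open>X\<close>.\<close>

lemma live_block_trace:
  assumes M: "M \<inter> \<Union>G = {}" and F: "{} \<notin> F"
    and C: "C \<in> generated_partition (F \<union> G)" "\<not> C \<subseteq> M"
  shows "C - M \<in> generated_partition (trace M (generated_partition F) \<union> G)"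
    (is "_ \<in> generated_partition (?Q \<union> G)")
  unfolding generated_partition_iff
proof (intro conjI allI impI)
  show "C - M \<noteq> {}" using C(2) by blast
  show "C - M \<subseteq> \<Union>(?Q \<union> G)"
  proof
    fix x assume x: "x \<in> C - M"
    then have "x \<in> \<Union>(F \<union> G)" using C(1) by (auto simp: generated_partition_iff)
    then consider "x \<in> \<Union>(generated_partition F)" | "x \<in> \<Union>G"
      using Union_generated_partition[of F] by auto
    then show "x \<in> \<Union>(?Q \<union> G)" using x by cases (auto simp: trace_def)
  qed
  have sat: "saturated F C" "saturated G C"
    using generated_partition_saturated[OF C(1)] by (auto simp: saturated_Un_iff)
  have "D \<subseteq> C \<or> D \<inter> C = {}" if "D \<in> generated_partition F" for D
    using generated_partition_minimal[OF that sat(1)] by blast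
  then have "D - M \<subseteq> C - M \<or> (D - M) \<inter> (C - M) = {}" if "D \<in> generated_partition F" for D
    using that by blast
  then have "saturated ?Q (C - M)" unfolding saturated_def trace_def by blast
  moreover have "saturated G (C - M)"
    using sat(2) M unfolding saturated_def by blast
  ultimately show "saturated (?Q \<union> G) (C - M)" by (simp add: saturated_Un_iff)
  fix X assume X: "saturated (?Q \<union> G) X" "X \<inter> (C - M) \<noteq> {}"
  define Y where "Y = \<Union>{D \<in> generated_partition F. D - M \<noteq> {} \<and> D - M \<subseteq> X} \<union> (X - M)"
  have XD: "D - M \<subseteq> X \<or> (D - M) \<inter> X = {}" if "D \<in> generated_partition F" for D
  proof (cases "D - M = {}")
    case False
    then have "D - M \<in> ?Q \<union> G" using that by (simp add: trace_def)
    with X(1) show ?thesis by (simp add: saturated_def)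
  qed blast
  have "saturated F Y"
    unfolding saturated_def
  proof
    fix A assume "A \<in> F"
    with F obtain D where D: "D \<in> generated_partition F" "A \<subseteq> D"
      by (metis generated_partition_above)
    show "A \<subseteq> Y \<or> A \<inter> Y = {}"
    proof (cases "D - M \<noteq> {} \<and> D - M \<subseteq> X")
      case True
      then show ?thesis using D by (auto simp: Y_def)
    next
      case False
      then have "(D - M) \<inter> X = {}" using XD D(1) by blast
      moreover have "D \<inter> E = {}"
        if "E \<in> generated_partition F" "E - M \<noteq> {}" "E - M \<subseteq> X" for E
        using generated_partition_eq_if_meet[OF D(1) that(1)] that False by blast
      ultimately show ?thesis using D(2) unfolding Y_def by blast
    qed
  qed
  moreover have "saturated G Y"
    unfolding saturated_def
  proof
    fix B assume B: "B \<in> G"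
    then have "B \<inter> M = {}" using M by blast
    moreover have "B \<subseteq> X \<or> B \<inter> X = {}" using X(1) B by (auto simp: saturated_def)
    ultimately show "B \<subseteq> Y \<or> B \<inter> Y = {}" unfolding Y_def by blast
  qed
  ultimately have "saturated (F \<union> G) Y" by (simp add: saturated_Un_iff)
  moreover have "Y \<inter> C \<noteq> {}" using X(2) unfolding Y_def by blast
  ultimately have "C \<subseteq> Y" by (rule generated_partition_minimal[OF C(1)])
  then show "C - M \<subseteq> X" unfolding Y_def by blast
qed

lemma live_block_trace_bij:
  assumes M: "M \<inter> \<Union>G = {}" and F: "{} \<notin> F"
  shows "bij_betw (\<lambda>C. C - M) {C \<in> generated_partition (F \<union> G). \<not> C \<subseteq> M}
    (generated_partition (trace M (generated_partition F) \<union> G))"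
    (is "bij_betw _ ?L (generated_partition ?QG)")
proof (rule bij_betw_imageI)
  show "inj_on (\<lambda>C. C - M) ?L"
  proof (rule inj_onI)
    fix C D assume "C \<in> ?L" "D \<in> ?L" "C - M = D - M"
    moreover from this have "C \<inter> D \<noteq> {}" by blast
    ultimately show "C = D" using generated_partition_eq_if_meet by blast
  qed
  show "(\<lambda>C. C - M) ` ?L = generated_partition ?QG"
  proof (rule generated_partition_eqI[symmetric])
    show "(\<lambda>C. C - M) ` ?L \<subseteq> generated_partition ?QG"
      using live_block_trace[OF M F] by blast
    have "x \<notin> M \<and> x \<in> \<Union>(F \<union> G)" if "x \<in> \<Union>?QG" for x
      using that M Union_generated_partition[of F] by (auto simp: trace_def)
    then show "\<Union>?QG \<subseteq> \<Union>((\<lambda>C. C - M) ` ?L)"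
      using Union_generated_partition[of "F \<union> G"] by blast
  qed
qed

section \<open>Weights and two-step gluing\<close>

text \<open>The total weight of the pieces inside \<open>C\<close>. Several families of pieces are kept apart,
  each with its own weights, since a set of middle vertices may be a block of both partitions.\<close>

definition content :: "'a set set \<Rightarrow> ('a set \<Rightarrow> int) \<Rightarrow> 'a set \<Rightarrow> int" where
  "content F u C = (\<Sum>A | A \<in> F \<and> A \<subseteq> C. u A)"

lemma content_eq_single:
  assumes "\<And>X. X \<in> F \<Longrightarrow> X \<subseteq> C \<longleftrightarrow> X = A \<and> b" "A \<in> F"
  shows "content F u C = (if b then u A else 0)"
proof -
  have "{X. X \<in> F \<and> X \<subseteq> C} = (if b then {A} else {})" using assms by auto
  then show ?thesis by (simp add: content_def)
qed

lemma block_subset_saturated_iff: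
  assumes "D \<in> generated_partition F" "saturated F C"
  shows "D \<subseteq> C \<longleftrightarrow> C \<inter> D \<noteq> {}"
proof
  show "C \<inter> D \<noteq> {}" if "D \<subseteq> C"
    using that assms(1) by (auto simp: generated_partition_iff)
  show "D \<subseteq> C" if "C \<inter> D \<noteq> {}"
    using generated_partition_minimal[OF assms that] .
qed

text \<open>A saturated set is a disjoint union of blocks, and every piece inside it lies in exactly one
  of them.\<close>

lemma content_eq_sum_blocks:
  assumes fin: "finite F'" "\<And>A. A \<in> F' \<Longrightarrow> finite A" and F: "{} \<notin> F" "F \<subseteq> F'"
    and C: "saturated F' C"
  shows "content F u C = (\<Sum>D | D \<in> generated_partition F' \<and> D \<subseteq> C. content F u D)"
proof -
  let ?Ds = "{D \<in> generated_partition F'. D \<subseteq> C}"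
  have "{A \<in> F. A \<subseteq> C} \<subseteq> (\<Union>D\<in>?Ds. {A \<in> F. A \<subseteq> D})"
  proof
    fix A assume A: "A \<in> {A \<in> F. A \<subseteq> C}"
    then have "A \<in> F'" "A \<noteq> {}" using F by auto
    then obtain D where D: "D \<in> generated_partition F'" "A \<subseteq> D"
      by (rule generated_partition_above)
    with A \<open>A \<noteq> {}\<close> have "C \<inter> D \<noteq> {}" by blast
    with D(1) C have "D \<subseteq> C" using block_subset_saturated_iff by blast
    with D A show "A \<in> (\<Union>D\<in>?Ds. {A \<in> F. A \<subseteq> D})" by blast
  qed
  then have "{A \<in> F. A \<subseteq> C} = (\<Union>D\<in>?Ds. {A \<in> F. A \<subseteq> D})" by blast
  moreover have "finite ?Ds" using finite_generated_partition(1)[OF fin] by simp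
  moreover have "finite F" using F(2) fin(1) by (rule finite_subset)
  moreover have "{A \<in> F. A \<subseteq> D} \<inter> {A \<in> F. A \<subseteq> E} = {}"
    if "D \<in> ?Ds" "E \<in> ?Ds" "D \<noteq> E" for D E
  proof -
    have "D \<inter> E = {}" using that generated_partition_eq_if_meet by blast
    then have "A = {}" if "A \<subseteq> D" "A \<subseteq> E" for A using that by blast
    then show ?thesis using F(1) by auto
  qed
  ultimately show ?thesis
    unfolding content_def by (simp add: sum.UNION_disjoint)
qed

lemma card_Int_eq_sum_blocks:
  assumes fin: "finite F'" "\<And>A. A \<in> F' \<Longrightarrow> finite A"
    and C: "saturated F' C" "C \<inter> M \<subseteq> \<Union>F'"
  shows "card (C \<inter> M) = (\<Sum>D | D \<in> generated_partition F' \<and> D \<subseteq> C. card (D \<inter> M))"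
proof -
  let ?Ds = "{D \<in> generated_partition F'. D \<subseteq> C}"
  have "C \<inter> M \<subseteq> (\<Union>D\<in>?Ds. D \<inter> M)"
  proof
    fix x assume x: "x \<in> C \<inter> M"
    then obtain D where D: "D \<in> generated_partition F'" "x \<in> D"
      using C(2) Union_generated_partition[of F'] by blast
    with x C(1) have "D \<subseteq> C" using block_subset_saturated_iff by blast
    with D x show "x \<in> (\<Union>D\<in>?Ds. D \<inter> M)" by blast
  qed
  then have "C \<inter> M = (\<Union>D\<in>?Ds. D \<inter> M)" by blast
  moreover have "card (\<Union>D\<in>?Ds. D \<inter> M) = (\<Sum>D\<in>?Ds. card (D \<inter> M))"
  proof (rule card_UN_disjoint)
    show "finite ?Ds" using finite_generated_partition(1)[OF fin] by simp
    show "\<forall>D\<in>?Ds. finite (D \<inter> M)" using finite_generated_partition(2)[OF fin] by simp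
    show "\<forall>D\<in>?Ds. \<forall>E\<in>?Ds. D \<noteq> E \<longrightarrow> D \<inter> M \<inter> (E \<inter> M) = {}"
      using generated_partition_eq_if_meet[of _ F'] by blast
  qed
  ultimately show ?thesis by simp
qed

text \<open>The label of a block of a gluing along \<open>M\<close>, minus \<open>1\<close>.\<close>

definition glued_weight ::
  "'a set set \<Rightarrow> ('a set \<Rightarrow> int) \<Rightarrow> 'a set set \<Rightarrow> ('a set \<Rightarrow> int) \<Rightarrow> 'a set \<Rightarrow> 'a set \<Rightarrow> int" where
  "glued_weight F u G v M C = content F u C + content G v C + int (card (C \<inter> M))"

lemma glued_weight_commute: "glued_weight F u G v M C = glued_weight G v F u M C"
  by (simp add: glued_weight_def)

text \<open>The pieces of \<open>F\<close> and \<open>G\<close> are glued along \<open>M\<close>, and the result is glued to \<open>H\<close> along \<open>N\<close>. The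
  hypotheses treat \<open>F\<close> and \<open>G\<close> alike, so that both bracketings of a triple composite are instances.\<close>

locale two_gluings =
  fixes F G H :: "'a set set" and u v w :: "'a set \<Rightarrow> int" and M N :: "'a set"
  assumes finite_system: "finite F" "finite G" "finite H"
    and finite_piece: "A \<in> F \<union> G \<union> H \<Longrightarrow> finite A"
    and nonempty_piece: "{} \<notin> F" "{} \<notin> G" "{} \<notin> H"
    and M_H: "M \<inter> \<Union>H = {}" and M_N: "M \<inter> N = {}"
begin

definition weight :: "'a set \<Rightarrow> int" where
  "weight C = content F u C + content G v C + content H w C + int (card (C \<inter> (M \<union> N)))"

abbreviation "FG \<equiv> generated_partition (F \<union> G)"
abbreviation "FGH \<equiv> generated_partition (F \<union> G \<union> H)"

lemma finite_FG: "finite FG"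
  and finite_FGH: "finite FGH" "C \<in> FGH \<Longrightarrow> finite C"
proof -
  have FG: "finite (F \<union> G)" "\<And>A. A \<in> F \<union> G \<Longrightarrow> finite A"
    and FGH: "finite (F \<union> G \<union> H)" using finite_system by (auto intro: finite_piece)
  show "finite FG" using finite_generated_partition(1)[OF FG] .
  show "finite FGH" "C \<in> FGH \<Longrightarrow> finite C"
    using finite_generated_partition[OF FGH finite_piece] by blast+
qed

lemma saturated_FGH: "C \<in> FGH \<Longrightarrow> saturated (F \<union> G) C" "C \<in> FGH \<Longrightarrow> saturated H C"
  using generated_partition_saturated[of C "F \<union> G \<union> H"] by (simp_all add: saturated_Un_iff)

lemma glued_weight_sum_blocks:
  assumes "saturated (F \<union> G) C" "C \<inter> M \<subseteq> \<Union>(F \<union> G)"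
  shows "glued_weight F u G v M C = (\<Sum>D | D \<in> FG \<and> D \<subseteq> C. glued_weight F u G v M D)"
proof -
  have fin: "finite (F \<union> G)" "\<And>A. A \<in> F \<union> G \<Longrightarrow> finite A"
    using finite_system finite_piece by auto
  show ?thesis
    unfolding glued_weight_def
    using content_eq_sum_blocks[OF fin nonempty_piece(1) Un_upper1 assms(1)]
      content_eq_sum_blocks[OF fin nonempty_piece(2) Un_upper2 assms(1)]
      card_Int_eq_sum_blocks[OF fin assms]
    by (simp add: sum.distrib)
qed

lemma dead_block_FGH_iff: "D \<subseteq> M \<Longrightarrow> D \<in> FGH \<longleftrightarrow> D \<in> FG"
  using dead_block_iff[OF M_H] .

lemma weight_dead_block:
  assumes "D \<subseteq> M" shows "weight D = glued_weight F u G v M D"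
proof -
  have "B = {}" if "B \<in> H" "B \<subseteq> D" for B using that assms M_H by blast
  then have "{B \<in> H. B \<subseteq> D} = {}" using nonempty_piece(3) by blast
  moreover have "D \<inter> (M \<union> N) = D \<inter> M" using assms by blast
  ultimately show ?thesis by (simp only: weight_def glued_weight_def content_def sum.empty add_0_right)
qed

context
  fixes q :: "'a set \<Rightarrow> int"
  \<comment> \<open>the weights that the traces of the live blocks carry into the second gluing\<close>
  assumes q: "\<forall>D\<in>FG. \<not> D \<subseteq> M \<longrightarrow> q (D - M) = glued_weight F u G v M D"
begin

abbreviation "FG_H \<equiv> generated_partition (trace M FG \<union> H)"

lemma live_bij: "bij_betw (\<lambda>C. C - M) {C \<in> FGH. \<not> C \<subseteq> M} FG_H"
proof -
  have "{} \<notin> F \<union> G" using nonempty_piece by simp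
  then show ?thesis by (rule live_block_trace_bij[OF M_H])
qed

lemma inj_on_live: "inj_on (\<lambda>C. C - M) {C \<in> FGH. \<not> C \<subseteq> M}"
  and FG_H_eq: "FG_H = (\<lambda>C. C - M) ` {C \<in> FGH. \<not> C \<subseteq> M}"
  using live_bij unfolding bij_betw_def by simp_all

text \<open>All blocks of \<open>F \<union> G\<close> inside a live block \<open>C\<close> are live: a dead one would itself be a block of
  \<open>F \<union> G \<union> H\<close> and hence all of \<open>C\<close>. So the pieces that the second gluing puts into \<open>C - M\<close> account for all
  pieces of \<open>F\<close> and \<open>G\<close> in \<open>C\<close> and for all vertices of \<open>C \<inter> M\<close>.\<close>

lemma weight_live_block:
  assumes C: "C \<in> FGH" "\<not> C \<subseteq> M"
  shows "glued_weight (trace M FG) q H w N (C - M) = weight C"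
proof -
  let ?Ds = "{D \<in> FG. D \<subseteq> C}"
  have live: "\<not> D \<subseteq> M" if "D \<in> ?Ds" for D
  proof
    assume "D \<subseteq> M"
    with that have "D \<in> FGH" using dead_block_FGH_iff by blast
    moreover have "C \<inter> D \<noteq> {}" using that by (auto simp: generated_partition_iff)
    ultimately have "D = C" using generated_partition_eq_if_meet C(1) by blast
    with \<open>D \<subseteq> M\<close> C(2) show False by blast
  qed
  have "bij_betw (\<lambda>D. D - M) ?Ds {X \<in> trace M FG. X \<subseteq> C - M}"
  proof (rule bij_betw_imageI)
    show "inj_on (\<lambda>D. D - M) ?Ds"
    proof (rule inj_onI)
      fix D E assume DE: "D \<in> ?Ds" "E \<in> ?Ds" "D - M = E - M"
      with live[OF DE(1)] have "D \<inter> E \<noteq> {}" by blast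
      with DE show "D = E" using generated_partition_eq_if_meet by blast
    qed
    show "(\<lambda>D. D - M) ` ?Ds = {X \<in> trace M FG. X \<subseteq> C - M}"
    proof
      show "(\<lambda>D. D - M) ` ?Ds \<subseteq> {X \<in> trace M FG. X \<subseteq> C - M}"
        using live by (auto simp: trace_def)
      show "{X \<in> trace M FG. X \<subseteq> C - M} \<subseteq> (\<lambda>D. D - M) ` ?Ds"
      proof
        fix X assume "X \<in> {X \<in> trace M FG. X \<subseteq> C - M}"
        then obtain D where D: "D \<in> FG" "X = D - M" "X \<noteq> {}" "X \<subseteq> C - M"
          by (auto simp: trace_def)
        then have "C \<inter> D \<noteq> {}" by blast
        then have "D \<subseteq> C"
          using block_subset_saturated_iff[OF D(1) saturated_FGH(1)[OF C(1)]] by blast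
        with D show "X \<in> (\<lambda>D. D - M) ` ?Ds" by blast
      qed
    qed
  qed
  then have "content (trace M FG) q (C - M) = (\<Sum>D\<in>?Ds. q (D - M))"
    unfolding content_def by (rule sum.reindex_bij_betw[symmetric])
  also have "\<dots> = (\<Sum>D\<in>?Ds. glued_weight F u G v M D)"
    using live q by (intro sum.cong) auto
  also have "\<dots> = glued_weight F u G v M C"
  proof (rule glued_weight_sum_blocks[symmetric])
    show "saturated (F \<union> G) C" using saturated_FGH(1)[OF C(1)] .
    have "C \<subseteq> \<Union>(F \<union> G \<union> H)" using C(1) by (simp add: generated_partition_iff)
    then show "C \<inter> M \<subseteq> \<Union>(F \<union> G)" using M_H by blast
  qed
  finally have 1: "content (trace M FG) q (C - M) = glued_weight F u G v M C" .
  have "{B \<in> H. B \<subseteq> C - M} = {B \<in> H. B \<subseteq> C}" using M_H by blast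
  then have 2: "content H w (C - M) = content H w C" by (simp add: content_def)
  have "(C - M) \<inter> N = C \<inter> N" using M_N by blast
  moreover have "card (C \<inter> (M \<union> N)) = card (C \<inter> M) + card (C \<inter> N)"
    using finite_FGH(2)[OF C(1)] M_N by (subst card_Un_disjoint[symmetric]) (auto intro: arg_cong[where f = card])
  ultimately show ?thesis
    unfolding weight_def glued_weight_def[of "trace M FG"] 1 2 by (simp add: glued_weight_def)
qed

lemma trace_trace: "trace N FG_H = trace (M \<union> N) FGH"
proof -
  have "trace N FG_H = (\<lambda>C. C - M - N) ` {C \<in> FGH. \<not> C \<subseteq> M} - {{}}"
    by (simp only: trace_def[of N] FG_H_eq image_image)
  also have "(\<lambda>C. C - M - N) = (\<lambda>C. C - (M \<union> N))" by blast
  also have "(\<lambda>C. C - (M \<union> N)) ` {C \<in> FGH. \<not> C \<subseteq> M} - {{}} = trace (M \<union> N) FGH"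
    unfolding trace_def by blast
  finally show ?thesis .
qed

lemma weight_trace_trace:
  assumes E: "E \<in> FG_H" and C: "C \<in> FGH" and eq: "E - N = C - (M \<union> N)" and ne: "E - N \<noteq> {}"
  shows "glued_weight (trace M FG) q H w N E = weight C"
proof -
  from E obtain C' where C': "C' \<in> FGH" "\<not> C' \<subseteq> M" "E = C' - M"
    unfolding FG_H_eq by blast
  then have "C \<inter> C' \<noteq> {}" using eq ne by blast
  then have "C = C'" using C C' generated_partition_eq_if_meet by blast
  then show ?thesis using C' weight_live_block by simp
qed

text \<open>A block that is dead at the end either died in the first gluing or survived it, and then its
  trace is dead in the second one.\<close>

lemma card_dead_blocks:
  "card {C \<in> FGH. C \<subseteq> M \<union> N \<and> weight C = i} =
    card {D \<in> FG. D \<subseteq> M \<and> glued_weight F u G v M D = i} +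
    card {E \<in> FG_H. E \<subseteq> N \<and> glued_weight (trace M FG) q H w N E = i}"
    (is "card ?all = card ?first + card ?second")
proof -
  let ?live = "{C \<in> FGH. \<not> C \<subseteq> M \<and> C \<subseteq> M \<union> N \<and> weight C = i}"
  have "?all = ?first \<union> ?live"
    using dead_block_FGH_iff weight_dead_block by auto
  moreover have "?first \<inter> ?live = {}" by blast
  ultimately have "card ?all = card ?first + card ?live"
    using finite_FG finite_FGH(1) by (simp add: card_Un_disjoint)
  moreover have "?second = (\<lambda>C. C - M) ` ?live"
  proof -
    have "C - M \<subseteq> N \<and> glued_weight (trace M FG) q H w N (C - M) = i \<longleftrightarrow> C \<subseteq> M \<union> N \<and> weight C = i"
      if "C \<in> FGH" "\<not> C \<subseteq> M" for C
      using weight_live_block[OF that] by (simp add: Diff_subset_conv)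
    then have "{C \<in> {C \<in> FGH. \<not> C \<subseteq> M}. C - M \<subseteq> N \<and>
        glued_weight (trace M FG) q H w N (C - M) = i} = ?live" by blast
    then show ?thesis unfolding FG_H_eq image_filter by simp
  qed
  moreover have "inj_on (\<lambda>C. C - M) ?live"
    using inj_on_live by (rule inj_on_subset) blast
  ultimately show ?thesis by (simp add: card_image)
qed

end

end

section \<open>Arrows presented by gluings\<close>

text \<open>A labelling, moved along \<open>e\<close> and shifted by \<open>1\<close> so as to become additive under gluing.\<close>

definition reduced :: "('b \<Rightarrow> 'a) \<Rightarrow> ('b set \<Rightarrow> int) \<Rightarrow> 'a set \<Rightarrow> int" where
  "reduced e g X = g (e -` X) - 1"

lemma inj_on_image_sets: "inj e \<Longrightarrow> inj_on (image e) S"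
  by (rule inj_onI) (simp add: inj_image_eq_iff)

lemma reduced_image: "inj e \<Longrightarrow> reduced e g (e ` A) = g A - 1"
  by (simp add: reduced_def inj_vimage_image_eq)

text \<open>The arrow is what remains when the vertices in \<open>M\<close> of the glued system with blocks \<open>P\<close> and
  weights \<open>L\<close> become interior. The map \<open>e\<close> places the outer vertices in the universe, and \<open>s\<close> collects
  the dead components that were present before gluing.\<close>

fun presents ::
  "(vertex \<Rightarrow> 'v) \<Rightarrow> 'v set \<Rightarrow> 'v set set \<Rightarrow> ('v set \<Rightarrow> int) \<Rightarrow> (int \<Rightarrow>\<^sub>0 int) \<Rightarrow> cob \<Rightarrow> bool" where
  "presents e M P L s (\<alpha>, g, s') \<longleftrightarrow>
    image e ` \<alpha> = trace M P \<and>
    g \<in> \<alpha> \<rightarrow>\<^sub>E UNIV \<and>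
    (\<forall>A\<in>\<alpha>. \<forall>C\<in>P. e ` A = C - M \<longrightarrow> g A = L C + 1) \<and>
    (\<forall>i. Poly_Mapping.lookup s' i = Poly_Mapping.lookup s i + int (card {C \<in> P. C \<subseteq> M \<and> L C + 1 = i}))"

lemma presents_unique:
  assumes "inj e" "presents e M P L s f" "presents e M P L s f'"
  shows "f = f'"
proof -
  obtain \<alpha> g t \<alpha>' g' t' where f: "f = (\<alpha>, g, t)" "f' = (\<alpha>', g', t')" by (metis prod_cases3)
  have "image e ` \<alpha> = image e ` \<alpha>'" using assms f by simp
  then have \<alpha>: "\<alpha> = \<alpha>'" by (rule inj_on_image_eq_iff[THEN iffD1, OF inj_on_image_sets[OF assms(1)] subset_UNIV subset_UNIV])
  have "g = g'"
  proof (rule PiE_ext)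
    show "g \<in> \<alpha> \<rightarrow>\<^sub>E UNIV" "g' \<in> \<alpha> \<rightarrow>\<^sub>E UNIV" using assms f \<alpha> by simp_all
    fix A assume A: "A \<in> \<alpha>"
    then have "e ` A \<in> trace M P" using assms(2) f by auto
    then obtain C where "C \<in> P" "e ` A = C - M" unfolding trace_def by blast
    then show "g A = g' A" using assms(2,3) f \<alpha> A by simp
  qed
  moreover have "t = t'" using assms(2,3) f by (intro poly_mapping_eqI) simp
  ultimately show ?thesis using f \<alpha> by simp
qed

lemma cob_homD:
  assumes "(\<alpha>, g, s) \<in> cob_hom m n"
  shows "partition_on ({1..m} <+> {1..n}) \<alpha>" "finite \<alpha>" "A \<in> \<alpha> \<Longrightarrow> finite A" "{} \<notin> \<alpha>"
    "g \<in> \<alpha> \<rightarrow>\<^sub>E UNIV" "\<Union>\<alpha> = {1..m} <+> {1..n}"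
proof -
  show part: "partition_on ({1..m} <+> {1..n}) \<alpha>" and "g \<in> \<alpha> \<rightarrow>\<^sub>E UNIV"
    using assms by (simp_all add: cob_hom_def partitions_def)
  have fin: "finite ({1..m} <+> {1..n})" by simp
  show "finite \<alpha>" using finite_elements[OF fin part] .
  show U: "\<Union>\<alpha> = {1..m} <+> {1..n}" and "{} \<notin> \<alpha>" using part by (simp_all add: partition_on_def)
  show "finite A" if "A \<in> \<alpha>"
    using that U fin by (metis Sup_upper finite_subset)
qed

lemma inj_emb: "inj emb12" "inj emb23" "inj emb13"
  unfolding emb12_def emb23_def emb13_def by (simp_all add: sum.inj_map)

lemma emb_eval [simp]:
  "emb12 (Inl i) = Inl i" "emb12 (Inr j) = Inr (Inl j)"
  "emb13 (Inl i) = Inl i" "emb13 (Inr j) = Inr (Inr j)"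
  "emb23 x = Inr x"
  by (simp_all add: emb12_def emb23_def emb13_def)

lemma range_emb13: "range emb13 = - middle"
proof -
  have "x \<in> range emb13 \<longleftrightarrow> x \<notin> middle" for x :: vertex3
  proof (cases x)
    case (Inl i)
    then have "x = emb13 (Inl i)" "x \<notin> middle" by (auto simp: middle_def)
    then show ?thesis by blast
  next
    case (Inr y)
    show ?thesis
    proof (cases y)
      case (Inl j)
      have "emb13 z \<noteq> Inr (Inl j)" for z by (cases z) auto
      with Inl \<open>x = Inr y\<close> have "x \<notin> range emb13" "x \<in> middle" by (force, simp add: middle_def)
      then show ?thesis by blast
    next
      case (Inr k)
      with \<open>x = Inr y\<close> have "x = emb13 (Inr k)" "x \<notin> middle" by (auto simp: middle_def)
      then show ?thesis by blast
    qed
  qed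
  then show ?thesis by blast
qed

lemma content_image:
  assumes "inj e" "inj f"
  shows "content (image (e \<circ> f) ` \<alpha>) (reduced (e \<circ> f) g) (e ` C) =
    (\<Sum>A | A \<in> \<alpha> \<and> f ` A \<subseteq> C. g A - 1)"
proof -
  let ?h = "e \<circ> f"
  have h: "inj ?h" using assms by (simp add: inj_compose)
  have "{X \<in> image ?h ` \<alpha>. X \<subseteq> e ` C} = image ?h ` {A \<in> \<alpha>. f ` A \<subseteq> C}"
  proof -
    have "?h ` A \<subseteq> e ` C \<longleftrightarrow> f ` A \<subseteq> C" for A
      using assms(1) by (simp only: image_comp[symmetric] inj_image_subset_iff)
    then show ?thesis by blast
  qed
  then have "content (image ?h ` \<alpha>) (reduced ?h g) (e ` C) =
      (\<Sum>A | A \<in> \<alpha> \<and> f ` A \<subseteq> C. reduced ?h g (?h ` A))"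
    by (simp only: content_def sum.reindex[OF inj_on_image_sets[OF h]] comp_def[of "reduced ?h g"])
  then show ?thesis by (simp only: reduced_image[OF h])
qed

lemma join_label_eq_glued_weight:
  assumes "inj e" "finite \<alpha>" "finite \<beta>"
  shows "join_label \<alpha> g \<beta> h C =
    glued_weight (image (e \<circ> emb12) ` \<alpha>) (reduced (e \<circ> emb12) g)
      (image (e \<circ> emb23) ` \<beta>) (reduced (e \<circ> emb23) h) (e ` middle) (e ` C) + 1"
proof -
  have "card (e ` C \<inter> e ` middle) = card (C \<inter> middle)"
    using assms(1) by (metis card_image image_Int inj_on_subset subset_UNIV)
  then show ?thesis
    unfolding glued_weight_def content_image[OF assms(1) inj_emb(1)]
      content_image[OF assms(1) inj_emb(2)] join_label_def
    by (simp add: sum_subtractf)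
qed

lemma generated_partition_eq_image_join:
  assumes "inj e"
  shows "generated_partition (image (e \<circ> emb12) ` \<alpha> \<union> image (e \<circ> emb23) ` \<beta>) = image e ` join \<alpha> \<beta>"
proof -
  have "image (e \<circ> emb12) ` \<alpha> \<union> image (e \<circ> emb23) ` \<beta> =
      image e ` (image emb12 ` \<alpha> \<union> image emb23 ` \<beta>)"
    by (simp add: image_Un image_image image_comp[symmetric])
  then show ?thesis using generated_partition_image[OF assms] by (simp add: join_def)
qed

lemma finite_join:
  assumes "(\<alpha>, g, s) \<in> cob_hom l m" "(\<beta>, h, t) \<in> cob_hom m n"
  shows "finite (join \<alpha> \<beta>)"
  unfolding join_def
proof (rule finite_generated_partition(1))
  show "finite (image emb12 ` \<alpha> \<union> image emb23 ` \<beta>)"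
    using cob_homD(2)[OF assms(1)] cob_homD(2)[OF assms(2)] by simp
  show "finite A" if "A \<in> image emb12 ` \<alpha> \<union> image emb23 ` \<beta>" for A
    using that cob_homD(3)[OF assms(1)] cob_homD(3)[OF assms(2)] by auto
qed

lemma emb13_image_vimage: "emb13 ` (emb13 -` C) = C - middle"
  by (simp add: image_vimage_eq range_emb13 Diff_eq)

text \<open>The universe is left free: composites are needed in the three-component vertex set and, through
  several embeddings \<open>e\<close>, in the four-component one.\<close>

lemma presents_cob_comp:
  assumes e: "inj e" and f: "(\<alpha>, g, s) \<in> cob_hom l m" "(\<beta>, h, t) \<in> cob_hom m n"
  defines "F \<equiv> image (e \<circ> emb12) ` \<alpha>" and "G \<equiv> image (e \<circ> emb23) ` \<beta>"
  shows "presents (e \<circ> emb13) (e ` middle) (generated_partition (F \<union> G))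
    (glued_weight F (reduced (e \<circ> emb12) g) G (reduced (e \<circ> emb23) h) (e ` middle))
    (s + t) (cob_comp (\<alpha>, g, s) (\<beta>, h, t))"
    (is "presents _ ?M ?P ?L _ _")
proof -
  have P: "?P = image e ` join \<alpha> \<beta>"
    unfolding F_def G_def by (rule generated_partition_eq_image_join[OF e])
  have L: "?L (e ` C) + 1 = join_label \<alpha> g \<beta> h C" for C
    unfolding F_def G_def
    using join_label_eq_glued_weight[OF e cob_homD(2)[OF f(1)] cob_homD(2)[OF f(2)]] by simp
  have diff: "e ` C - ?M = e ` (C - middle)" for C
    using e by (simp add: image_set_diff)
  let ?k = "\<lambda>X \<in> partition_comp \<alpha> \<beta>. join_label \<alpha> g \<beta> h (THE C. C \<in> join \<alpha> \<beta> \<and> emb13 ` X \<subseteq> C)"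
  let ?b = "\<lambda>i. int (card {D \<in> dead_blocks \<alpha> \<beta>. join_label \<alpha> g \<beta> h D = i})"
  have "image (e \<circ> emb13) ` partition_comp \<alpha> \<beta> = trace ?M ?P"
  proof -
    have "image (e \<circ> emb13) ` partition_comp \<alpha> \<beta> =
        (\<lambda>C. e ` emb13 ` (emb13 -` C)) ` join \<alpha> \<beta> - {{}}"
      unfolding partition_comp_def by (auto simp: image_comp[symmetric])
    then show ?thesis
      unfolding P trace_def image_image diff emb13_image_vimage .
  qed
  moreover have "?k X = ?L D + 1"
    if X: "X \<in> partition_comp \<alpha> \<beta>" and D: "D \<in> ?P" "(e \<circ> emb13) ` X = D - ?M" for X D
  proof -
    from D(1) obtain C where C: "C \<in> join \<alpha> \<beta>" "D = e ` C" unfolding P by blast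
    with D(2) have "e ` emb13 ` X = e ` (C - middle)" by (simp add: diff image_comp)
    then have XC: "emb13 ` X = C - middle" using e by (simp add: inj_image_eq_iff)
    have "X \<noteq> {}" using X by (simp add: partition_comp_def)
    have "(THE C. C \<in> join \<alpha> \<beta> \<and> emb13 ` X \<subseteq> C) = C"
    proof (rule the_equality)
      show "C \<in> join \<alpha> \<beta> \<and> emb13 ` X \<subseteq> C" using C XC by blast
      fix C' assume C': "C' \<in> join \<alpha> \<beta> \<and> emb13 ` X \<subseteq> C'"
      then have "C' \<inter> C \<noteq> {}" using XC \<open>X \<noteq> {}\<close> by blast
      then show "C' = C" using C C' generated_partition_eq_if_meet unfolding join_def by blast
    qed
    then show ?thesis using X L C(2) by simp
  qed
  moreover have "Poly_Mapping.lookup (s + t + Abs_poly_mapping ?b) i =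
      Poly_Mapping.lookup (s + t) i + int (card {D \<in> ?P. D \<subseteq> ?M \<and> ?L D + 1 = i})" for i
  proof -
    have "{i. ?b i \<noteq> 0} \<subseteq> join_label \<alpha> g \<beta> h ` join \<alpha> \<beta>"
    proof
      fix i assume "i \<in> {i. ?b i \<noteq> 0}"
      then have "{D \<in> dead_blocks \<alpha> \<beta>. join_label \<alpha> g \<beta> h D = i} \<noteq> {}"
        by (metis (mono_tags, lifting) card.empty mem_Collect_eq of_nat_0)
      then show "i \<in> join_label \<alpha> g \<beta> h ` join \<alpha> \<beta>" unfolding dead_blocks_def by blast
    qed
    then have "finite {i. ?b i \<noteq> 0}" using finite_join[OF f] finite_surj by blast
    then have "Poly_Mapping.lookup (Abs_poly_mapping ?b) i = ?b i" by (simp add: Abs_poly_mapping_inverse)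
    moreover have "{D \<in> ?P. D \<subseteq> ?M \<and> ?L D + 1 = i} =
        image e ` {D \<in> dead_blocks \<alpha> \<beta>. join_label \<alpha> g \<beta> h D = i}"
      unfolding P dead_blocks_def using L e by (auto simp: inj_image_subset_iff)
    moreover note inj_on_image_sets[OF e]
    ultimately show ?thesis by (simp add: lookup_add card_image)
  qed
  ultimately show ?thesis by (auto simp: cob_comp_def)
qed

lemma partition_on_trace: "partition_on A P \<Longrightarrow> partition_on (A - M) (trace M P)"
  unfolding partition_on_def trace_def disjoint_def by blast

lemma partition_on_image_inv:
  assumes "inj e" "partition_on (e ` A) (image e ` P)"
  shows "partition_on A P"
proof (rule partition_onI)
  have "e ` \<Union>P = e ` A" using assms(2) by (simp only: partition_on_def image_Union)
  then show "\<Union>P = A" using assms(1) by (simp add: inj_image_eq_iff)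
  show "{} \<notin> P" using assms(2) by (auto simp: partition_on_def)
  fix X Y assume XY: "X \<in> P" "Y \<in> P" "X \<noteq> Y"
  then have "e ` X \<noteq> e ` Y" using assms(1) by (simp add: inj_image_eq_iff)
  then have "e ` X \<inter> e ` Y = {}"
    using assms(2) XY unfolding partition_on_def disjoint_def by blast
  then show "disjnt X Y" by (auto simp: disjnt_def)
qed

lemma cob_comp_in_hom:
  assumes "f \<in> cob_hom l m" "f' \<in> cob_hom m n"
  shows "cob_comp f f' \<in> cob_hom l n"
proof -
  obtain \<alpha> g s \<beta> h t where f: "f = (\<alpha>, g, s)" "f' = (\<beta>, h, t)" by (metis prod_cases3)
  obtain \<kappa> k r where c: "cob_comp f f' = (\<kappa>, k, r)" by (metis prod_cases3)
  let ?F = "image emb12 ` \<alpha> \<union> image emb23 ` \<beta>"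
  have p: "image emb13 ` \<kappa> = trace middle (generated_partition ?F)" "k \<in> \<kappa> \<rightarrow>\<^sub>E UNIV"
    using presents_cob_comp[OF inj_on_id, of \<alpha> g s l m \<beta> h t n] assms f c by simp_all
  have "\<Union>?F = emb12 ` \<Union>\<alpha> \<union> emb23 ` \<Union>\<beta>" by blast
  also have "\<dots> = emb12 ` ({1..l} <+> {1..m}) \<union> emb23 ` ({1..m} <+> {1..n})"
    using cob_homD(6) assms f by metis
  also have "\<dots> - middle = emb13 ` ({1..l} <+> {1..n})"
    by (auto simp: Plus_def middle_def image_Un image_image)
  finally have "partition_on (emb13 ` ({1..l} <+> {1..n})) (image emb13 ` \<kappa>)"
    using partition_on_trace[OF partition_on_generated_partition[of ?F], of middle] p(1) by simp
  then show ?thesis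
    using partition_on_image_inv[OF inj_emb(3)] p(2) by (simp add: c cob_hom_def partitions_def)
qed

text \<open>Two successive gluings present the same arrow as one gluing of all pieces.\<close>

lemma (in two_gluings) presents_two_gluings:
  assumes e: "inj e" "presents e M FG (glued_weight F u G v M) s (\<kappa>, k, s')"
    and e': "presents e' N (generated_partition (image e ` \<kappa> \<union> H))
      (glued_weight (image e ` \<kappa>) (reduced e k) H w N) (s' + r) f"
  shows "presents e' (M \<union> N) FGH weight (s + r) f"
proof -
  obtain \<alpha> g t where f: "f = (\<alpha>, g, t)" by (metis prod_cases3)
  have \<kappa>: "image e ` \<kappa> = trace M FG" using e(2) by simp
  have q: "\<forall>D\<in>FG. \<not> D \<subseteq> M \<longrightarrow> reduced e k (D - M) = glued_weight F u G v M D"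
  proof (intro ballI impI)
    fix D assume D: "D \<in> FG" "\<not> D \<subseteq> M"
    have "D - M \<in> image e ` \<kappa>" unfolding \<kappa> trace_def using D by blast
    then obtain X where X: "X \<in> \<kappa>" "e ` X = D - M" by force
    then have "k X = glued_weight F u G v M D + 1" using e(2) D(1) by simp
    then show "reduced e k (D - M) = glued_weight F u G v M D"
      using reduced_image[OF e(1), of k X] X(2) by simp
  qed
  note tt = trace_trace[OF q] and wt = weight_trace_trace[OF q] and cd = card_dead_blocks[OF q]
  let ?Q = "generated_partition (trace M FG \<union> H)"
  let ?wt = "glued_weight (trace M FG) (reduced e k) H w N"
  have E: "image e' ` \<alpha> = trace N ?Q" "g \<in> \<alpha> \<rightarrow>\<^sub>E UNIV"
    and lab: "\<And>A E. \<lbrakk>A \<in> \<alpha>; E \<in> ?Q; e' ` A = E - N\<rbrakk> \<Longrightarrow> g A = ?wt E + 1"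
    and t: "\<And>i. Poly_Mapping.lookup t i = Poly_Mapping.lookup (s' + r) i + int (card {E \<in> ?Q. E \<subseteq> N \<and> ?wt E + 1 = i})"
    using e' f \<kappa> by simp_all
  have "g A = weight C + 1" if A: "A \<in> \<alpha>" "C \<in> FGH" "e' ` A = C - (M \<union> N)" for A C
  proof -
    have "e' ` A \<in> trace N ?Q" using A(1) E(1) by blast
    then obtain X where X: "X \<in> ?Q" "e' ` A = X - N" "X - N \<noteq> {}" unfolding trace_def by blast
    then show ?thesis using lab[OF A(1) X(1,2)] wt[OF X(1) A(2)] A(3) by simp
  qed
  moreover have "Poly_Mapping.lookup t i = Poly_Mapping.lookup (s + r) i + int (card {C \<in> FGH. C \<subseteq> M \<union> N \<and> weight C + 1 = i})" for i
  proof -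
    have "Poly_Mapping.lookup s' i = Poly_Mapping.lookup s i + int (card {D \<in> FG. D \<subseteq> M \<and> glued_weight F u G v M D + 1 = i})"
      using e(2) by simp
    \<comment> \<open>a block of label \<open>i\<close> has weight \<open>i - 1\<close>\<close>
    then show ?thesis
      using cd[of "i - 1"] t[of i] by (simp add: lookup_add eq_diff_eq)
  qed
  ultimately show ?thesis using f E tt by simp
qed

section \<open>Associativity\<close>

text \<open>The four components are the vertex sets of the objects of three composable arrows. The maps
  below include three of them; \<open>emb4_comp\<close> says that the ways of including two of them agree.\<close>

type_synonym vertex4 = "nat + nat + nat + nat"

definition emb123 :: "vertex3 \<Rightarrow> vertex4" where "emb123 = map_sum id emb12"
definition emb134 :: "vertex3 \<Rightarrow> vertex4" where "emb134 = map_sum id emb23"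
definition emb124 :: "vertex3 \<Rightarrow> vertex4" where "emb124 = map_sum id emb13"
definition emb234 :: "vertex3 \<Rightarrow> vertex4" where "emb234 = Inr"

lemma inj_emb4: "inj emb123" "inj emb134" "inj emb124" "inj emb234"
  unfolding emb123_def emb134_def emb124_def emb234_def by (simp_all add: sum.inj_map inj_emb)

lemma emb4_comp:
  "emb124 \<circ> emb12 = emb123 \<circ> emb12"
  "emb234 \<circ> emb12 = emb123 \<circ> emb23"
  "emb134 \<circ> emb12 = emb123 \<circ> emb13"
  "emb234 \<circ> emb23 = emb134 \<circ> emb23"
  "emb124 \<circ> emb23 = emb234 \<circ> emb13"
  "emb124 \<circ> emb13 = emb134 \<circ> emb13"
  unfolding emb123_def emb134_def emb124_def emb234_def emb12_def emb23_def emb13_def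
  by (simp_all add: sum.map_comp o_def map_sum.simps fun_eq_iff)

definition middle2 :: "vertex4 set" where "middle2 = range (\<lambda>j. Inr (Inl j))"
definition middle3 :: "vertex4 set" where "middle3 = range (\<lambda>k. Inr (Inr (Inl k)))"

lemma image_middle:
  "emb123 ` middle = middle2" "emb124 ` middle = middle2"
  "emb134 ` middle = middle3" "emb234 ` middle = middle3"
  unfolding middle_def middle2_def middle3_def emb123_def emb134_def emb124_def emb234_def
  by (simp_all add: image_image)

definition system1 :: "vertex set set \<Rightarrow> vertex4 set set" where
  "system1 \<alpha> = image (emb123 \<circ> emb12) ` \<alpha>"
definition system2 :: "vertex set set \<Rightarrow> vertex4 set set" where
  "system2 \<beta> = image (emb123 \<circ> emb23) ` \<beta>"
definition system3 :: "vertex set set \<Rightarrow> vertex4 set set" where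
  "system3 \<gamma> = image (emb134 \<circ> emb23) ` \<gamma>"

definition weight1 :: "(vertex set \<Rightarrow> int) \<Rightarrow> vertex4 set \<Rightarrow> int" where
  "weight1 = reduced (emb123 \<circ> emb12)"
definition weight2 :: "(vertex set \<Rightarrow> int) \<Rightarrow> vertex4 set \<Rightarrow> int" where
  "weight2 = reduced (emb123 \<circ> emb23)"
definition weight3 :: "(vertex set \<Rightarrow> int) \<Rightarrow> vertex4 set \<Rightarrow> int" where
  "weight3 = reduced (emb134 \<circ> emb23)"

definition triple_weight where
  "triple_weight \<alpha> g \<beta> h \<gamma> k C =
    content (system1 \<alpha>) (weight1 g) C + content (system2 \<beta>) (weight2 h) C +
    content (system3 \<gamma>) (weight3 k) C + int (card (C \<inter> (middle2 \<union> middle3)))"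

context
  fixes a b c l m n p \<alpha> g s \<beta> h t \<gamma> k r
  assumes abc: "a \<in> cob_hom l m" "b \<in> cob_hom m n" "c \<in> cob_hom n p"
    and a: "a = (\<alpha>, g, s)" and b: "b = (\<beta>, h, t)" and c: "c = (\<gamma>, k, r)"
begin

abbreviation "triple_blocks \<equiv> generated_partition (system1 \<alpha> \<union> system2 \<beta> \<union> system3 \<gamma>)"

lemma finite_systems: "finite (system1 \<alpha>)" "finite (system2 \<beta>)" "finite (system3 \<gamma>)"
  using cob_homD(2)[OF abc(1)[unfolded a]] cob_homD(2)[OF abc(2)[unfolded b]]
    cob_homD(2)[OF abc(3)[unfolded c]]
  by (simp_all add: system1_def system2_def system3_def)

lemma finite_pieces: "A \<in> system1 \<alpha> \<union> system2 \<beta> \<union> system3 \<gamma> \<Longrightarrow> finite A"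
  using cob_homD(3)[OF abc(1)[unfolded a]] cob_homD(3)[OF abc(2)[unfolded b]]
    cob_homD(3)[OF abc(3)[unfolded c]]
  unfolding system1_def system2_def system3_def by auto

lemma nonempty_pieces: "{} \<notin> system1 \<alpha>" "{} \<notin> system2 \<beta>" "{} \<notin> system3 \<gamma>"
  using cob_homD(4)[OF abc(1)[unfolded a]] cob_homD(4)[OF abc(2)[unfolded b]]
    cob_homD(4)[OF abc(3)[unfolded c]]
  unfolding system1_def system2_def system3_def by auto

lemma middle_disjoint:
  "middle2 \<inter> middle3 = {}" "middle2 \<inter> \<Union>(system3 \<gamma>) = {}" "middle3 \<inter> \<Union>(system1 \<alpha>) = {}"
proof -
  show "middle2 \<inter> middle3 = {}" by (auto simp: middle2_def middle3_def)
  have "(emb134 \<circ> emb23) x \<notin> middle2" for x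
    by (cases x) (auto simp: middle2_def emb134_def)
  then show "middle2 \<inter> \<Union>(system3 \<gamma>) = {}" unfolding system3_def by blast
  have "(emb123 \<circ> emb12) x \<notin> middle3" for x
    by (cases x) (auto simp: middle3_def emb123_def)
  then show "middle3 \<inter> \<Union>(system1 \<alpha>) = {}" unfolding system1_def by blast
qed

lemma presents_left:
  "presents (emb134 \<circ> emb13) (middle2 \<union> middle3) triple_blocks
    (triple_weight \<alpha> g \<beta> h \<gamma> k) (s + t + r) (cob_comp (cob_comp a b) c)"
proof -
  interpret two_gluings "system1 \<alpha>" "system2 \<beta>" "system3 \<gamma>" "weight1 g" "weight2 h" "weight3 k"
    middle2 middle3
    by unfold_locales
      (use finite_systems finite_pieces nonempty_pieces middle_disjoint in \<open>simp_all\<close>)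
  obtain \<kappa> q s' where ab: "cob_comp a b = (\<kappa>, q, s')" by (metis prod_cases3)
  have hom: "cob_comp a b \<in> cob_hom l n" using abc by (simp add: cob_comp_in_hom)
  have "presents (emb123 \<circ> emb13) middle2 FG
      (glued_weight (system1 \<alpha>) (weight1 g) (system2 \<beta>) (weight2 h) middle2) (s + t) (\<kappa>, q, s')"
    using presents_cob_comp[OF inj_emb4(1), of \<alpha> g s l m \<beta> h t n] abc
    by (simp only: a b ab[symmetric] image_middle system1_def system2_def weight1_def weight2_def)
  moreover have "presents (emb134 \<circ> emb13) middle3
      (generated_partition (image (emb123 \<circ> emb13) ` \<kappa> \<union> system3 \<gamma>))
      (glued_weight (image (emb123 \<circ> emb13) ` \<kappa>) (reduced (emb123 \<circ> emb13) q)
        (system3 \<gamma>) (weight3 k) middle3) (s' + r) (cob_comp (cob_comp a b) c)"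
    using presents_cob_comp[OF inj_emb4(2), of \<kappa> q s' l n \<gamma> k r p] abc hom
    by (simp only: c ab image_middle system3_def weight3_def emb4_comp)
  moreover have "inj (emb123 \<circ> emb13)" using inj_emb inj_emb4 by (simp add: inj_compose)
  ultimately have "presents (emb134 \<circ> emb13) (middle2 \<union> middle3) triple_blocks weight (s + t + r)
      (cob_comp (cob_comp a b) c)" by (intro presents_two_gluings)
  moreover have "weight = triple_weight \<alpha> g \<beta> h \<gamma> k"
    by (simp add: fun_eq_iff weight_def triple_weight_def)
  ultimately show ?thesis by simp
qed

text \<open>This is again an instance of \<open>two_gluings\<close>, with the roles rotated: first the second and third
  systems are glued, then the first one is added. The triple gluing does not depend on
  the order of the three systems.\<close>

lemma presents_right:
  "presents (emb134 \<circ> emb13) (middle2 \<union> middle3) triple_blocks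
    (triple_weight \<alpha> g \<beta> h \<gamma> k) (s + t + r) (cob_comp a (cob_comp b c))"
proof -
  interpret two_gluings "system2 \<beta>" "system3 \<gamma>" "system1 \<alpha>" "weight2 h" "weight3 k" "weight1 g"
    middle3 middle2
    by unfold_locales
      (use finite_systems finite_pieces nonempty_pieces middle_disjoint in \<open>auto\<close>)
  obtain \<kappa> q s' where bc: "cob_comp b c = (\<kappa>, q, s')" by (metis prod_cases3)
  have hom: "cob_comp b c \<in> cob_hom m p" using abc by (simp add: cob_comp_in_hom)
  have "presents (emb234 \<circ> emb13) middle3 FG
      (glued_weight (system2 \<beta>) (weight2 h) (system3 \<gamma>) (weight3 k) middle3) (t + r) (\<kappa>, q, s')"
    using presents_cob_comp[OF inj_emb4(4), of \<beta> h t m n \<gamma> k r p] abc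
    by (simp only: b c bc[symmetric] image_middle system2_def system3_def weight2_def weight3_def emb4_comp)
  moreover have "presents (emb134 \<circ> emb13) middle2
      (generated_partition (image (emb234 \<circ> emb13) ` \<kappa> \<union> system1 \<alpha>))
      (glued_weight (image (emb234 \<circ> emb13) ` \<kappa>) (reduced (emb234 \<circ> emb13) q)
        (system1 \<alpha>) (weight1 g) middle2) (s' + s) (cob_comp a (cob_comp b c))"
  proof -
    have "presents (emb124 \<circ> emb13) middle2
        (generated_partition (system1 \<alpha> \<union> image (emb234 \<circ> emb13) ` \<kappa>))
        (glued_weight (system1 \<alpha>) (weight1 g) (image (emb234 \<circ> emb13) ` \<kappa>)
          (reduced (emb234 \<circ> emb13) q) middle2) (s + s') (cob_comp a (cob_comp b c))"
      using presents_cob_comp[OF inj_emb4(3), of \<alpha> g s l m \<kappa> q s' p] abc hom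
      by (simp only: a bc image_middle system1_def weight1_def emb4_comp(1,5))
    then show ?thesis
      by (simp only: emb4_comp(6) Un_commute[of "system1 \<alpha>"] add.commute[of s]
          glued_weight_commute[of "system1 \<alpha>", abs_def])
  qed
  moreover have "inj (emb234 \<circ> emb13)" using inj_emb inj_emb4 by (simp add: inj_compose)
  ultimately have "presents (emb134 \<circ> emb13) (middle3 \<union> middle2) FGH weight (t + r + s)
      (cob_comp a (cob_comp b c))" by (intro presents_two_gluings)
  moreover have "weight = triple_weight \<alpha> g \<beta> h \<gamma> k"
    by (simp add: fun_eq_iff weight_def triple_weight_def Un_commute)
  moreover have "system2 \<beta> \<union> system3 \<gamma> \<union> system1 \<alpha> = system1 \<alpha> \<union> system2 \<beta> \<union> system3 \<gamma>" by blast
  moreover have "middle3 \<union> middle2 = middle2 \<union> middle3" by blast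
  moreover have "t + r + s = s + t + r" by (simp add: ac_simps)
  ultimately show ?thesis by (simp only:)
qed

end

lemma inj_emb14: "inj (emb134 \<circ> emb13)"
  using inj_emb inj_emb4 by (simp add: inj_compose)

lemma cob_comp_assoc:
  assumes "a \<in> cob_hom l m" "b \<in> cob_hom m n" "c \<in> cob_hom n p"
  shows "cob_comp (cob_comp a b) c = cob_comp a (cob_comp b c)"
proof -
  obtain \<alpha> g s \<beta> h t \<gamma> k r where "a = (\<alpha>, g, s)" "b = (\<beta>, h, t)" "c = (\<gamma>, k, r)"
    by (metis prod_cases3)
  then show ?thesis
    using presents_unique[OF inj_emb14 presents_left[OF assms] presents_right[OF assms]] by blast
qed

lemma cob_hom_unique:
  assumes "f \<in> cob_hom m n" "f \<in> cob_hom m' n'"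
  shows "m = m' \<and> n = n'"
proof -
  obtain \<alpha> g s where f: "f = (\<alpha>, g, s)" by (metis prod_cases3)
  have "{1..m} <+> {1..n} = {1..m'} <+> {1..n'}"
    using cob_homD(6) assms unfolding f by metis
  then have "Inl -` ({1..m} <+> {1..n}) = Inl -` ({1..m'} <+> {1..n'})"
    "Inr -` ({1..m} <+> {1..n}) = Inr -` ({1..m'} <+> {1..n'})" by simp_all
  moreover have "Inl -` (A <+> B) = A" "Inr -` (A <+> B) = B" for A B :: "nat set"
    by auto
  ultimately have "{1..m} = {1..m'}" "{1..n} = {1..n'}" by (simp_all only:)
  then have "card {1..m} = card {1..m'}" "card {1..n} = card {1..n'}" by (simp_all only:)
  then show ?thesis by simp
qed

section \<open>Identities\<close>

text \<open>Gluing on cylinders. Each vertex \<open>x\<close> of the partition \<open>F\<close> of \<open>V\<close> that lies in \<open>M\<close> is joined by a piece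
  \<open>{x, \<phi> x}\<close> to a fresh vertex \<open>\<phi> x\<close> outside \<open>M\<close>; once \<open>M\<close> is removed, \<open>x\<close> has been renamed to
  \<open>\<phi> x\<close>.\<close>

context
  fixes F Z :: "'v set set" and V M :: "'v set" and \<phi> :: "'v \<Rightarrow> 'v"
  assumes F: "partition_on V F"
    and \<phi>: "inj_on \<phi> (V \<inter> M)" "\<phi> ` (V \<inter> M) \<inter> (V \<union> M) = {}"
    and Z: "Z = (\<lambda>x. {x, \<phi> x}) ` (V \<inter> M)"
begin

lemma generated_partition_cylinder: "generated_partition (F \<union> Z) = (\<lambda>A. A \<union> \<phi> ` (A \<inter> M)) ` F"
proof (rule generated_partition_eqI)
  have UF: "\<Union>F = V" using F by (simp add: partition_on_def)
  show "\<Union>(F \<union> Z) \<subseteq> \<Union>((\<lambda>A. A \<union> \<phi> ` (A \<inter> M)) ` F)"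
    using UF unfolding Z by blast
  show "(\<lambda>A. A \<union> \<phi> ` (A \<inter> M)) ` F \<subseteq> generated_partition (F \<union> Z)"
  proof
    fix C assume "C \<in> (\<lambda>A. A \<union> \<phi> ` (A \<inter> M)) ` F"
    then obtain A where A: "A \<in> F" and C: "C = A \<union> \<phi> ` (A \<inter> M)" by blast
    then have AV: "A \<subseteq> V" "A \<noteq> {}" using F UF by (auto simp: partition_on_def)
    show "C \<in> generated_partition (F \<union> Z)"
      unfolding generated_partition_iff saturated_Un_iff
    proof (intro conjI allI impI)
      show "C \<noteq> {}" using AV by (simp add: C)
      show "C \<subseteq> \<Union>(F \<union> Z)" using A AV unfolding C Z by blast
      show "saturated F C"
        unfolding saturated_def
      proof
        fix B assume B: "B \<in> F"
        then have "B = A \<or> B \<inter> A = {}" using A F by (auto simp: partition_on_def disjoint_def)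
        moreover have "B \<inter> \<phi> ` (A \<inter> M) = {}" using B UF \<phi>(2) AV by blast
        ultimately show "B \<subseteq> C \<or> B \<inter> C = {}" unfolding C by blast
      qed
      show "saturated Z C"
        unfolding saturated_def
      proof
        fix z assume "z \<in> Z"
        then obtain x where x: "z = {x, \<phi> x}" "x \<in> V \<inter> M" unfolding Z by blast
        show "z \<subseteq> C \<or> z \<inter> C = {}"
        proof (cases "x \<in> A")
          case True
          then show ?thesis using x unfolding C by blast
        next
          case False
          have "x \<notin> \<phi> ` (A \<inter> M)" "\<phi> x \<notin> A" using x \<phi>(2) AV by blast+
          moreover have "\<phi> x \<notin> \<phi> ` (A \<inter> M)"
            using False x AV \<phi>(1) by (auto simp: inj_on_def)
          ultimately show ?thesis using False unfolding x C by blast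
        qed
      qed
      fix X assume X: "saturated F X \<and> saturated Z X" "X \<inter> C \<noteq> {}"
      have Zx: "x \<in> X \<longleftrightarrow> \<phi> x \<in> X" if "x \<in> A \<inter> M" for x
      proof -
        have "{x, \<phi> x} \<in> Z" using that AV unfolding Z by blast
        with X(1) have "{x, \<phi> x} \<subseteq> X \<or> {x, \<phi> x} \<inter> X = {}"
          unfolding saturated_def by (elim conjE) (erule bspec)
        then show ?thesis by blast
      qed
      then have "A \<inter> X \<noteq> {}" using X(2) unfolding C by blast
      then have "A \<subseteq> X" using X(1) A by (auto simp: saturated_def)
      then show "C \<subseteq> X" using Zx unfolding C by blast
    qed
  qed
qed

text \<open>A cylinder has label \<open>0\<close>, that is weight \<open>-1\<close>, which cancels the middle vertex it adds.\<close>

lemma glued_weight_cylinder: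
  assumes A: "A \<in> F" and v: "\<And>z. z \<in> Z \<Longrightarrow> v z = - 1"
  shows "glued_weight F u Z v M (A \<union> \<phi> ` (A \<inter> M)) = u A"
proof -
  let ?C = "A \<union> \<phi> ` (A \<inter> M)"
  have AV: "A \<subseteq> V" "A \<noteq> {}" using A F by (auto simp: partition_on_def)
  have "content F u ?C = (if True then u A else 0)"
  proof (rule content_eq_single[OF _ A])
    fix B assume B: "B \<in> F"
    then have "B \<noteq> {}" "B \<subseteq> V" using F by (auto simp: partition_on_def)
    then have "B \<subseteq> ?C \<longleftrightarrow> B \<subseteq> A" using \<phi>(2) AV by blast
    also have "\<dots> \<longleftrightarrow> B = A"
      using A B F \<open>B \<noteq> {}\<close> by (auto simp: partition_on_def disjoint_def)
    finally show "B \<subseteq> ?C \<longleftrightarrow> B = A \<and> True" by simp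
  qed
  moreover have "content Z v ?C = - int (card (A \<inter> M))"
  proof -
    have "{z. z \<in> Z \<and> z \<subseteq> ?C} = (\<lambda>x. {x, \<phi> x}) ` (A \<inter> M)"
      unfolding Z using AV \<phi>(2) by blast
    moreover have "inj_on (\<lambda>x. {x, \<phi> x}) (A \<inter> M)"
    proof (rule inj_onI)
      fix x y assume "x \<in> A \<inter> M" "y \<in> A \<inter> M" "{x, \<phi> x} = {y, \<phi> y}"
      then show "x = y" using \<phi>(2) AV by blast
    qed
    moreover have "content Z v ?C = (\<Sum>z | z \<in> Z \<and> z \<subseteq> ?C. - 1)"
      unfolding content_def using v by (intro sum.cong) auto
    ultimately show ?thesis by (simp add: card_image)
  qed
  moreover have "?C \<inter> M = A \<inter> M" using \<phi>(2) AV by blast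
  ultimately show ?thesis by (simp add: glued_weight_def)
qed

end

text \<open>Every block \<open>A\<close> keeps a vertex outside \<open>M\<close>: a vertex not in \<open>M\<close>, or the far end of a cylinder.
  Therefore no block dies.\<close>

lemma presents_cylinder:
  assumes f: "(\<alpha>, g, s) \<in> cob_hom m n" and e: "inj e" "inj e'"
    and \<phi>: "inj_on \<phi> (e ` \<Union>\<alpha> \<inter> M)" "\<phi> ` (e ` \<Union>\<alpha> \<inter> M) \<inter> (e ` \<Union>\<alpha> \<union> M) = {}"
    and e': "\<And>x. x \<in> \<Union>\<alpha> \<Longrightarrow> e' x = (if e x \<in> M then \<phi> (e x) else e x)"
    and Z: "Z = (\<lambda>x. {x, \<phi> x}) ` (e ` \<Union>\<alpha> \<inter> M)"
    and v: "\<And>z. z \<in> Z \<Longrightarrow> v z = - 1"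
  defines "F \<equiv> image e ` \<alpha>"
  shows "presents e' M (generated_partition (F \<union> Z)) (glued_weight F (reduced e g) Z v M) s (\<alpha>, g, s)"
proof -
  let ?C = "\<lambda>A. e ` A \<union> \<phi> ` (e ` A \<inter> M)"
  have part: "partition_on (e ` \<Union>\<alpha>) F"
  proof (rule partition_onI)
    show "\<Union>F = e ` \<Union>\<alpha>" "{} \<notin> F" using cob_homD(4)[OF f] by (auto simp: F_def)
    fix X Y assume "X \<in> F" "Y \<in> F" "X \<noteq> Y"
    then obtain A B where AB: "A \<in> \<alpha>" "B \<in> \<alpha>" "X = e ` A" "Y = e ` B" "A \<noteq> B"
      by (auto simp: F_def)
    then have "A \<inter> B = {}"
      using cob_homD(1)[OF f] by (auto simp: partition_on_def disjoint_def)
    then show "disjnt X Y" using AB e(1) by (auto simp: disjnt_def dest: injD)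
  qed
  note gen = generated_partition_cylinder[OF part \<phi> Z]
  have wt: "glued_weight F (reduced e g) Z v M (?C A) = g A - 1" if "A \<in> \<alpha>" for A
    using glued_weight_cylinder[OF part \<phi> Z, of "e ` A" v "reduced e g"] v that reduced_image[OF e(1)]
    by (simp add: F_def)
  have P: "generated_partition (F \<union> Z) = ?C ` \<alpha>"
    unfolding gen by (simp add: F_def image_image)
  have live: "?C A - M = e' ` A" if "A \<in> \<alpha>" for A
  proof -
    have "e' ` A = (\<lambda>x. if e x \<in> M then \<phi> (e x) else e x) ` A"
      using that by (intro image_cong refl e') blast
    also have "\<dots> = (e ` A - M) \<union> \<phi> ` (e ` A \<inter> M)" by auto
    also have "\<dots> = ?C A - M" using \<phi>(2) that by blast
    finally show ?thesis by simp
  qed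
  have ne: "?C A - M \<noteq> {}" if "A \<in> \<alpha>" for A
    using live[OF that] cob_homD(4)[OF f] that by auto
  have tr: "image e' ` \<alpha> = trace M (?C ` \<alpha>)"
  proof -
    have "{} \<notin> (\<lambda>A. ?C A - M) ` \<alpha>" using ne by (metis (no_types, lifting) imageE)
    then have "trace M (?C ` \<alpha>) = (\<lambda>A. ?C A - M) ` \<alpha>" 
      unfolding trace_def image_image by (simp only: Diff_insert0 Diff_empty not_False_eq_True)
    also have "\<dots> = image e' ` \<alpha>" by (intro image_cong refl live)
    finally show ?thesis by (rule sym)
  qed
  have "g A = glued_weight F (reduced e g) Z v M C + 1"
    if A: "A \<in> \<alpha>" "C \<in> ?C ` \<alpha>" "e' ` A = C - M" for A C
  proof -
    from A(2) obtain B where B: "B \<in> \<alpha>" "C = ?C B" by blast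
    then have "e' ` A = e' ` B" using A(3) live by simp
    then have "A = B" using e(2) by (simp add: inj_image_eq_iff)
    then show ?thesis using wt[OF B(1)] B(2) by simp
  qed
  then have lab: "\<forall>A\<in>\<alpha>. \<forall>C\<in>?C ` \<alpha>. e' ` A = C - M \<longrightarrow>
      g A = glued_weight F (reduced e g) Z v M C + 1" by (intro ballI impI)
  have "{C \<in> ?C ` \<alpha>. C \<subseteq> M \<and> glued_weight F (reduced e g) Z v M C + 1 = i} = {}" for i
  proof -
    have "\<not> C \<subseteq> M" if "C \<in> ?C ` \<alpha>" for C
    proof -
      from that obtain A where "A \<in> \<alpha>" "C = ?C A" by (rule imageE)
      then show ?thesis using ne[of A] by (simp only: Diff_eq_empty_iff) simp
    qed
    then show ?thesis by blast
  qed
  then have "\<forall>i. Poly_Mapping.lookup s i = Poly_Mapping.lookup s i +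
      int (card {C \<in> ?C ` \<alpha>. C \<subseteq> M \<and> glued_weight F (reduced e g) Z v M C + 1 = i})"
    by (simp only: card.empty) simp
  with tr lab show ?thesis
    using cob_homD(5)[OF f] unfolding P presents.simps by (intro conjI)
qed

definition cob_id :: "nat \<Rightarrow> cob" where
  "cob_id m = ((\<lambda>i. {Inl i, Inr i}) ` {1..m}, \<lambda>X \<in> (\<lambda>i. {Inl i, Inr i}) ` {1..m}. 0, 0)"

lemma cob_id_in_hom: "cob_id m \<in> cob_hom m m"
proof -
  have "partition_on ({1..m} <+> {1..m}) ((\<lambda>i. {Inl i, Inr i}) ` {1..m})"
    by (rule partition_onI) (auto simp: disjnt_def)
  then show ?thesis by (simp add: cob_id_def cob_hom_def partitions_def)
qed

lemma Union_Int_middle: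
  assumes "(\<alpha>, g, s) \<in> cob_hom m n"
  shows "emb12 ` \<Union>\<alpha> \<inter> middle = (\<lambda>j. Inr (Inl j)) ` {1..n}"
    "emb23 ` \<Union>\<alpha> \<inter> middle = (\<lambda>j. Inr (Inl j)) ` {1..m}"
  unfolding cob_homD(6)[OF assms] by (auto simp: middle_def Plus_def image_Un image_image)

lemma cob_id_left:
  assumes "f \<in> cob_hom m n" shows "cob_comp (cob_id m) f = f"
proof -
  obtain \<alpha> g s where f: "f = (\<alpha>, g, s)" by (metis prod_cases3)
  obtain \<iota> o0 z where i: "cob_id m = (\<iota>, o0, z)" by (metis prod_cases3)
  have \<iota>: "\<iota> = (\<lambda>i. {Inl i, Inr i}) ` {1..m}" "o0 = (\<lambda>X \<in> \<iota>. 0)" "z = 0"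
    using i by (auto simp: cob_id_def)
  \<comment> \<open>from the middle component, the only place where its value matters, to the incoming one\<close>
  define \<phi> :: "vertex3 \<Rightarrow> vertex3" where "\<phi> = case_sum Inl (case_sum Inl undefined)"
  note hom = cob_id_in_hom[of m, unfolded i] assms[unfolded f]
  let ?F = "image emb23 ` \<alpha>" and ?Z = "image emb12 ` \<iota>"
  have "presents emb13 middle (generated_partition (?Z \<union> ?F))
      (glued_weight ?Z (reduced emb12 o0) ?F (reduced emb23 g) middle) (0 + s) (cob_comp (cob_id m) f)"
    using presents_cob_comp[OF inj_on_id hom] by (simp add: f i \<iota>(3))
  then have 1: "presents emb13 middle (generated_partition (?F \<union> ?Z))
      (glued_weight ?F (reduced emb23 g) ?Z (reduced emb12 o0) middle) s (cob_comp (cob_id m) f)"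
    by (simp only: Un_commute[of ?Z] glued_weight_commute[of ?Z, abs_def] add_0)
  have 2: "presents emb13 middle (generated_partition (?F \<union> ?Z))
      (glued_weight ?F (reduced emb23 g) ?Z (reduced emb12 o0) middle) s f"
    unfolding f
  proof (rule presents_cylinder[where \<phi> = \<phi>, OF hom(2) inj_emb(2,3)])
    note UM = Union_Int_middle(2)[OF hom(2)]
    show "inj_on \<phi> (emb23 ` \<Union>\<alpha> \<inter> middle)"
      unfolding UM by (auto simp: inj_on_def \<phi>_def)
    show "\<phi> ` (emb23 ` \<Union>\<alpha> \<inter> middle) \<inter> (emb23 ` \<Union>\<alpha> \<union> middle) = {}"
      unfolding UM by (auto simp: \<phi>_def middle_def)
    show "emb13 x = (if emb23 x \<in> middle then \<phi> (emb23 x) else emb23 x)" for x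
      by (cases x) (auto simp: \<phi>_def middle_def)
    show "?Z = (\<lambda>x. {x, \<phi> x}) ` (emb23 ` \<Union>\<alpha> \<inter> middle)"
      unfolding UM \<iota>(1) by (simp add: image_image \<phi>_def insert_commute)
    show "reduced emb12 o0 z = - 1" if "z \<in> ?Z" for z
      using that reduced_image[OF inj_emb(1), of o0] by (auto simp: \<iota>(2))
  qed
  show ?thesis by (rule presents_unique[OF inj_emb(3) 1 2])
qed

lemma cob_id_right:
  assumes "f \<in> cob_hom m n" shows "cob_comp f (cob_id n) = f"
proof -
  obtain \<alpha> g s where f: "f = (\<alpha>, g, s)" by (metis prod_cases3)
  obtain \<iota> o0 z where i: "cob_id n = (\<iota>, o0, z)" by (metis prod_cases3)
  have \<iota>: "\<iota> = (\<lambda>i. {Inl i, Inr i}) ` {1..n}" "o0 = (\<lambda>X \<in> \<iota>. 0)" "z = 0"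
    using i by (auto simp: cob_id_def)
  \<comment> \<open>from the middle component, the only place where its value matters, to the outgoing one\<close>
  define \<phi> :: "vertex3 \<Rightarrow> vertex3" where "\<phi> = case_sum undefined (case_sum (Inr \<circ> Inr) undefined)"
  note hom = assms[unfolded f] cob_id_in_hom[of n, unfolded i]
  let ?F = "image emb12 ` \<alpha>" and ?Z = "image emb23 ` \<iota>"
  have 1: "presents emb13 middle (generated_partition (?F \<union> ?Z))
      (glued_weight ?F (reduced emb12 g) ?Z (reduced emb23 o0) middle) s (cob_comp f (cob_id n))"
    using presents_cob_comp[OF inj_on_id hom] by (simp add: f i \<iota>(3))
  have 2: "presents emb13 middle (generated_partition (?F \<union> ?Z))
      (glued_weight ?F (reduced emb12 g) ?Z (reduced emb23 o0) middle) s f"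
    unfolding f
  proof (rule presents_cylinder[where \<phi> = \<phi>, OF hom(1) inj_emb(1,3)])
    note UM = Union_Int_middle(1)[OF hom(1)]
    show "inj_on \<phi> (emb12 ` \<Union>\<alpha> \<inter> middle)"
      unfolding UM by (auto simp: inj_on_def \<phi>_def)
    have "emb12 x \<noteq> Inr (Inr k)" for x k by (cases x) auto
    then show "\<phi> ` (emb12 ` \<Union>\<alpha> \<inter> middle) \<inter> (emb12 ` \<Union>\<alpha> \<union> middle) = {}"
      unfolding UM by (auto simp: \<phi>_def middle_def) metis
    show "emb13 x = (if emb12 x \<in> middle then \<phi> (emb12 x) else emb12 x)" for x
      by (cases x) (auto simp: \<phi>_def middle_def)
    show "?Z = (\<lambda>x. {x, \<phi> x}) ` (emb12 ` \<Union>\<alpha> \<inter> middle)"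
      unfolding UM \<iota>(1) by (simp add: image_image \<phi>_def)
    show "reduced emb23 o0 z = - 1" if "z \<in> ?Z" for z
      using that reduced_image[OF inj_emb(2), of o0] by (auto simp: \<iota>(2))
  qed
  show ?thesis by (rule presents_unique[OF inj_emb(3) 1 2])
qed

section \<open>The involution\<close>

lemma flip_flip [simp]: "flip (flip x) = x"
  by (cases x) (simp_all add: flip_def)

lemma inj_flip: "inj flip"
  by (metis flip_flip injI)

lemma image_flip_flip [simp]: "flip ` flip ` A = A"
  by (simp add: image_image)

lemma partition_star_star [simp]: "partition_star (partition_star \<alpha>) = \<alpha>"
  by (simp add: partition_star_def image_image)

lemma flip_image_in_partition_star [simp]: "flip ` A \<in> partition_star \<alpha> \<longleftrightarrow> A \<in> \<alpha>"
  unfolding partition_star_def by (simp add: inj_image_mem_iff inj_on_image_sets[OF inj_flip])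

lemma card_flip_image [simp]: "card (flip ` A) = card A"
  using inj_flip by (simp add: card_image inj_on_subset)

lemma flip_image_subset_range:
  "flip ` A \<subseteq> range Inl \<longleftrightarrow> A \<subseteq> range Inr" "flip ` A \<subseteq> range Inr \<longleftrightarrow> A \<subseteq> range Inl"
proof -
  have "flip x \<in> range Inl \<longleftrightarrow> x \<in> range Inr" "flip x \<in> range Inr \<longleftrightarrow> x \<in> range Inl" for x
    by (cases x; auto simp: flip_def)+
  then show "flip ` A \<subseteq> range Inl \<longleftrightarrow> A \<subseteq> range Inr" "flip ` A \<subseteq> range Inr \<longleftrightarrow> A \<subseteq> range Inl"
    by blast+
qed

lemma ub_lb_star: "ub (partition_star \<alpha>) = lb \<alpha>" "lb (partition_star \<alpha>) = ub \<alpha>"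
proof -
  have "{C \<in> partition_star \<alpha>. C \<subseteq> range Inl} = image flip ` {C \<in> \<alpha>. C \<subseteq> range Inr}"
    "{C \<in> partition_star \<alpha>. C \<subseteq> range Inr} = image flip ` {C \<in> \<alpha>. C \<subseteq> range Inl}"
    by (simp_all only: partition_star_def image_filter flip_image_subset_range)
  then show "ub (partition_star \<alpha>) = lb \<alpha>" "lb (partition_star \<alpha>) = ub \<alpha>"
    unfolding ub_def lb_def by (simp_all add: card_image inj_on_image_sets[OF inj_flip])
qed

lemma cob_star_in_hom:
  assumes "f \<in> cob_hom m n" shows "cob_star f \<in> cob_hom n m"
proof -
  obtain \<alpha> g s where f: "f = (\<alpha>, g, s)" by (metis prod_cases3)
  have "flip ` ({1..n} <+> {1..m}) = {1..m} <+> {1..n}"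
    by (auto simp: Plus_def image_Un image_image flip_def)
  moreover have "image flip ` partition_star \<alpha> = \<alpha>"
    by (simp add: partition_star_def image_image)
  ultimately have "partition_on ({1..n} <+> {1..m}) (partition_star \<alpha>)"
    using partition_on_image_inv[OF inj_flip] cob_homD(1) assms unfolding f by metis
  then show ?thesis unfolding f cob_star_def by (simp add: cob_hom_def partitions_def)
qed

lemma cob_star_star:
  assumes "f \<in> cob_hom m n" shows "cob_star (cob_star f) = f"
proof -
  obtain \<alpha> g s where f: "f = (\<alpha>, g, s)" by (metis prod_cases3)
  let ?g = "\<lambda>X \<in> partition_star \<alpha>. let C = flip ` X in - g C - int (card C) + 2"
  have "(\<lambda>X \<in> \<alpha>. let C = flip ` X in - ?g C - int (card C) + 2) = g"
  proof (rule PiE_ext)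
    show "g \<in> \<alpha> \<rightarrow>\<^sub>E UNIV" using cob_homD(5) assms f by blast
    show "(\<lambda>X \<in> \<alpha>. let C = flip ` X in - ?g C - int (card C) + 2) \<in> \<alpha> \<rightarrow>\<^sub>E UNIV" by simp
  qed (simp add: Let_def)
  moreover have "Poly_Mapping.update 1 (- Poly_Mapping.lookup (Poly_Mapping.update 1
      (- Poly_Mapping.lookup s 1 - int (ub \<alpha>) - int (lb \<alpha>)) (- s)) 1 - int (lb \<alpha>) - int (ub \<alpha>))
      (- Poly_Mapping.update 1 (- Poly_Mapping.lookup s 1 - int (ub \<alpha>) - int (lb \<alpha>)) (- s)) = s"
    by (rule poly_mapping_eqI) (simp add: lookup_update)
  ultimately show ?thesis by (simp only: f cob_star_def case_prod_conv partition_star_star ub_lb_star)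
qed

lemma system_star:
  "system2 (partition_star \<alpha>) = image (emb123 \<circ> emb23 \<circ> flip) ` \<alpha>"
  by (simp add: system2_def partition_star_def image_image)

text \<open>The triple gluing of \<open>\<alpha>\<close>, \<open>\<alpha>\<^sup>*\<close>, \<open>\<alpha>\<close>. The maps \<open>f1\<close>, \<open>f2\<close>, \<open>f3\<close> send a block \<open>A\<close> of \<open>\<alpha>\<close> to its
  three copies; consecutive copies share their outgoing vertices (in the second component) and
  their incoming vertices (in the third), respectively. The map \<open>proj\<close> folds the zigzag back
  onto \<open>\<alpha>\<close> and is a left inverse of all three. Copies of different blocks are therefore disjoint, and each \<open>A\<close>
  can be treated separately.\<close>

context
  fixes m n :: nat and \<alpha> :: "vertex set set" and g and s :: "int \<Rightarrow>\<^sub>0 int"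
  assumes f: "(\<alpha>, g, s) \<in> cob_hom m n"
begin

private definition f1 :: "vertex \<Rightarrow> vertex4" where "f1 = emb123 \<circ> emb12"
private definition f2 :: "vertex \<Rightarrow> vertex4" where "f2 = emb123 \<circ> emb23 \<circ> flip"
private definition f3 :: "vertex \<Rightarrow> vertex4" where "f3 = emb134 \<circ> emb23"
private definition f14 :: "vertex \<Rightarrow> vertex4" where "f14 = emb134 \<circ> emb13"
private definition proj :: "vertex4 \<Rightarrow> vertex" where
  "proj = case_sum Inl (case_sum Inr (case_sum Inl Inr))"
private abbreviation "M \<equiv> middle2 \<union> middle3"

private lemma f_eval:
  "f1 (Inl i) = Inl i" "f1 (Inr j) = Inr (Inl j)"
  "f2 (Inl i) = Inr (Inr (Inl i))" "f2 (Inr j) = Inr (Inl j)"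
  "f3 (Inl i) = Inr (Inr (Inl i))" "f3 (Inr j) = Inr (Inr (Inr j))"
  "f14 (Inl i) = Inl i" "f14 (Inr j) = Inr (Inr (Inr j))"
  by (simp_all add: f1_def f2_def f3_def f14_def emb123_def emb134_def flip_def)

private lemma proj_f: "proj (f1 x) = x" "proj (f2 x) = x" "proj (f3 x) = x" "proj (f14 x) = x"
  by (cases x; simp add: f_eval proj_def)+

private lemma proj_image_f [simp]:
  "proj ` f1 ` A = A" "proj ` f2 ` A = A" "proj ` f3 ` A = A" "proj ` f14 ` A = A"
  by (simp_all add: image_image proj_f)

private lemma f_relations:
  "f1 x \<in> M \<longleftrightarrow> x \<in> range Inr" "f2 x \<in> M" "f3 x \<in> M \<longleftrightarrow> x \<in> range Inl"
  "x \<in> range Inr \<Longrightarrow> f2 x = f1 x" "x \<in> range Inl \<Longrightarrow> f2 x = f3 x"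
  "x \<in> range Inl \<Longrightarrow> f14 x = f1 x" "x \<in> range Inr \<Longrightarrow> f14 x = f3 x"
  "f1 x \<noteq> f3 y" "x \<in> range Inl \<or> x \<in> range Inr"
  by (cases x; cases y; simp add: f_eval middle2_def middle3_def image_iff)+

text \<open>If \<open>A\<close> meets both sides, its three copies are connected. Otherwise the middle copy coincides
  with one of the outer copies and is disjoint from the other.\<close>

private definition zigzag_blocks :: "vertex set \<Rightarrow> vertex4 set set" where
  "zigzag_blocks A = (if A \<subseteq> range Inl \<or> A \<subseteq> range Inr then {f1 ` A, f3 ` A}
    else {f1 ` A \<union> f2 ` A \<union> f3 ` A})"

private lemma lower_eq: "A \<subseteq> range Inr \<Longrightarrow> f2 ` A = f1 ` A"
  and upper_eq: "A \<subseteq> range Inl \<Longrightarrow> f2 ` A = f3 ` A"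
  by (intro image_cong refl f_relations; blast)+

private lemma proj_zigzag_block: "C \<in> zigzag_blocks A \<Longrightarrow> proj ` C = A"
proof -
  assume "C \<in> zigzag_blocks A"
  then have "C = f1 ` A \<or> C = f3 ` A \<or> C = f1 ` A \<union> f2 ` A \<union> f3 ` A"
    by (auto simp: zigzag_blocks_def split: if_splits)
  then show "proj ` C = A" by (elim disjE) (simp_all only: image_Un proj_image_f Un_absorb)
qed

private lemma block_disjoint: "A \<in> \<alpha> \<Longrightarrow> B \<in> \<alpha> \<Longrightarrow> A \<noteq> B \<Longrightarrow> A \<inter> B = {}"
  using partition_onD2[OF cob_homD(1)[OF f]] by (rule disjointD)

private lemma block_nonempty: "A \<in> \<alpha> \<Longrightarrow> A \<noteq> {}"
  using cob_homD(4)[OF f] by blast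

private lemma block_subset_iff: "A \<in> \<alpha> \<Longrightarrow> B \<in> \<alpha> \<Longrightarrow> A \<subseteq> B \<longleftrightarrow> A = B"
  using block_disjoint block_nonempty by (metis Int_absorb2 order_refl)

private abbreviation "pieces \<equiv> system1 \<alpha> \<union> system2 (partition_star \<alpha>) \<union> system3 \<alpha>"

private lemma systems:
  "system1 \<alpha> = image f1 ` \<alpha>" "system2 (partition_star \<alpha>) = image f2 ` \<alpha>" "system3 \<alpha> = image f3 ` \<alpha>"
  unfolding system_star system1_def system3_def f1_def f2_def f3_def by (rule refl)+

private lemma zigzag_block_covers:
  assumes "A \<in> \<alpha>" "X \<in> {f1 ` A, f2 ` A, f3 ` A}"
  shows "\<exists>C \<in> zigzag_blocks A. X \<subseteq> C"
proof (cases "A \<subseteq> range Inl \<or> A \<subseteq> range Inr")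
  case True
  then have "f2 ` A \<in> {f1 ` A, f3 ` A}" by (elim disjE) (simp_all only: lower_eq upper_eq insert_iff simp_thms)
  then have "X \<in> zigzag_blocks A" using True assms(2) by (auto simp only: zigzag_blocks_def if_True)
  then show ?thesis by blast
next
  case False
  then have "zigzag_blocks A = {f1 ` A \<union> f2 ` A \<union> f3 ` A}" by (simp only: zigzag_blocks_def if_False)
  moreover have "X \<subseteq> f1 ` A \<union> f2 ` A \<union> f3 ` A" using assms(2) by blast
  ultimately show ?thesis by simp
qed

private lemma zigzag_piece_cases:
  assumes "A \<in> \<alpha>" "C \<in> zigzag_blocks A" "X \<in> {f1 ` A, f2 ` A, f3 ` A}"
  shows "X \<subseteq> C \<or> X \<inter> C = {}"
proof -
  have "f1 ` A \<inter> f3 ` A = {}" using f_relations(8) by blast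
  then have d: "Y \<subseteq> Y' \<or> Y \<inter> Y' = {}" if "Y \<in> {f1 ` A, f3 ` A}" "Y' \<in> {f1 ` A, f3 ` A}" for Y Y'
    using that by blast
  show ?thesis
  proof (cases "A \<subseteq> range Inl \<or> A \<subseteq> range Inr")
    case True
    then have "f2 ` A \<in> {f1 ` A, f3 ` A}" by (elim disjE) (simp_all only: lower_eq upper_eq insert_iff simp_thms)
    then have "X \<in> {f1 ` A, f3 ` A}" using assms(3) by blast
    moreover have "C \<in> {f1 ` A, f3 ` A}" using assms(2) True by (simp only: zigzag_blocks_def if_True)
    ultimately show ?thesis by (rule d)
  next
    case False
    then have "C = f1 ` A \<union> f2 ` A \<union> f3 ` A" using assms(2) by (simp only: zigzag_blocks_def if_False singleton_iff)
    then show ?thesis using assms(3) by blast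
  qed
qed

private lemma generated_partition_zigzag:
  "generated_partition pieces = (\<Union>A\<in>\<alpha>. zigzag_blocks A)"
proof (rule generated_partition_eqI)
  show "\<Union>pieces \<subseteq> \<Union>(\<Union>A\<in>\<alpha>. zigzag_blocks A)"
  proof
    fix x assume "x \<in> \<Union>pieces"
    then obtain A X where "A \<in> \<alpha>" "X \<in> {f1 ` A, f2 ` A, f3 ` A}" "x \<in> X"
      unfolding systems by blast
    moreover from this obtain C where "C \<in> zigzag_blocks A" "X \<subseteq> C" using zigzag_block_covers by metis
    ultimately show "x \<in> \<Union>(\<Union>A\<in>\<alpha>. zigzag_blocks A)" by blast
  qed
  show "(\<Union>A\<in>\<alpha>. zigzag_blocks A) \<subseteq> generated_partition pieces"
  proof
    fix C assume "C \<in> (\<Union>A\<in>\<alpha>. zigzag_blocks A)"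
    then obtain A where A: "A \<in> \<alpha>" and C: "C \<in> zigzag_blocks A" by blast
    have mem: "f1 ` A \<in> pieces" "f2 ` A \<in> pieces" "f3 ` A \<in> pieces"
      using A by (simp_all add: systems)
    show "C \<in> generated_partition pieces"
      unfolding generated_partition_iff
    proof (intro conjI allI impI)
      show "C \<noteq> {}" using proj_zigzag_block[OF C] block_nonempty[OF A] by auto
      have "C \<subseteq> f1 ` A \<union> f2 ` A \<union> f3 ` A" using C by (auto simp: zigzag_blocks_def split: if_splits)
      then show "C \<subseteq> \<Union>pieces" using mem by blast
      show "saturated pieces C"
        unfolding saturated_def
      proof
        fix X assume "X \<in> pieces"
        then obtain B where B: "B \<in> \<alpha>" "X \<in> {f1 ` B, f2 ` B, f3 ` B}" unfolding systems by blast
        show "X \<subseteq> C \<or> X \<inter> C = {}"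
        proof (cases "B = A")
          case True
          then show ?thesis using zigzag_piece_cases[OF A C] B(2) by simp
        next
          case False
          have "proj ` X = B" using B(2) by (elim insertE emptyE) simp_all
          then have "proj ` X \<inter> proj ` C = {}"
            using block_disjoint[OF B(1) A False] proj_zigzag_block[OF C] by simp
          then show ?thesis by blast
        qed
      qed
      fix S assume S: "saturated pieces S" "S \<inter> C \<noteq> {}"
      have sat: "X \<subseteq> S" if "X \<in> pieces" "X \<inter> S \<noteq> {}" for X
        using S(1) that unfolding saturated_def by blast
      show "C \<subseteq> S"
      proof (cases "A \<subseteq> range Inl \<or> A \<subseteq> range Inr")
        case True
        then have "C \<in> pieces" using C mem by (auto simp: zigzag_blocks_def)
        then show ?thesis using sat S(2) by blast
      next
        case False
        then have C': "C = f1 ` A \<union> f2 ` A \<union> f3 ` A" using C by (simp add: zigzag_blocks_def)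
        from False obtain x y where xy: "x \<in> A" "x \<in> range Inr" "y \<in> A" "y \<in> range Inl"
          using f_relations(9) by blast
        then have "f1 x \<in> f1 ` A \<inter> f2 ` A" "f3 y \<in> f2 ` A \<inter> f3 ` A"
          using f_relations(4,5) by (metis IntI imageI)+
        moreover have "f1 ` A \<inter> S \<noteq> {} \<or> f2 ` A \<inter> S \<noteq> {} \<or> f3 ` A \<inter> S \<noteq> {}"
          using S(2) unfolding C' by blast
        ultimately show ?thesis using sat[OF mem(1)] sat[OF mem(2)] sat[OF mem(3)] unfolding C' by blast
      qed
    qed
  qed
qed

private abbreviation "g' \<equiv> fst (snd (cob_star (\<alpha>, g, s)))"
private abbreviation "wt \<equiv> triple_weight \<alpha> g (partition_star \<alpha>) g' \<alpha> g"

private lemma inj_f: "inj f1" "inj f2" "inj f3" "inj f14"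
  using proj_f by (metis injI)+

private lemma zigzag_weight:
  assumes A: "A \<in> \<alpha>" and C: "proj ` C \<subseteq> A"
  shows "wt C = (if f1 ` A \<subseteq> C then g A - 1 else 0) +
    (if f2 ` A \<subseteq> C then 1 - g A - int (card A) else 0) +
    (if f3 ` A \<subseteq> C then g A - 1 else 0) + int (card (C \<inter> M))"
proof -
  have sub: "B = A" if "B \<in> \<alpha>" "h ` B \<subseteq> C" "proj ` h ` B = B" for B h
  proof -
    have "B \<subseteq> A" using image_mono[OF that(2), of proj] that(3) C by blast
    then show ?thesis using block_subset_iff that(1) A by blast
  qed
  have content: "content (image h ` \<alpha>) u C = (if h ` A \<subseteq> C then u (h ` A) else 0)"
    if "\<And>B. proj ` h ` B = B" for h u
  proof (rule content_eq_single)
    show "h ` A \<in> image h ` \<alpha>" using A by simp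
    fix X assume "X \<in> image h ` \<alpha>"
    then obtain B where B: "B \<in> \<alpha>" "X = h ` B" by blast
    show "X \<subseteq> C \<longleftrightarrow> X = h ` A \<and> h ` A \<subseteq> C"
      using sub[OF B(1) _ that] B(2) by metis
  qed
  have w1: "weight1 g (f1 ` A) = g A - 1"
    unfolding weight1_def f1_def[symmetric] by (rule reduced_image[OF inj_f(1)])
  have w3: "weight3 g (f3 ` A) = g A - 1"
    unfolding weight3_def f3_def[symmetric] by (rule reduced_image[OF inj_f(3)])
  have "weight2 g' (f2 ` A) = g' (flip ` A) - 1"
    using reduced_image[of "emb123 \<circ> emb23" g' "flip ` A"] inj_emb inj_emb4
    by (simp add: weight2_def f2_def inj_compose image_comp)
  also have "\<dots> = 1 - g A - int (card A)"
    using A by (simp add: cob_star_def)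
  finally have w2: "weight2 g' (f2 ` A) = 1 - g A - int (card A)" .
  show ?thesis
    unfolding triple_weight_def systems by (simp add: content w1 w2 w3)
qed

text \<open>The only block arising from an \<open>A\<close> with vertices on both sides has weight
  \<open>(g A - 1) + (1 - g A - card A) + (g A - 1) + card A = g A - 1\<close>. For one-sided \<open>A\<close>, one outer copy
  stays alone and keeps its weight, while the two coinciding copies form a block inside \<open>M\<close> of weight
  \<open>(g A - 1) + (1 - g A - card A) + card A = 0\<close>.\<close>

private lemma zigzag_block_cases:
  assumes A: "A \<in> \<alpha>" and C: "C \<in> zigzag_blocks A"
  shows "C - M = f14 ` A \<and> wt C = g A - 1 \<or>
    C \<subseteq> M \<and> wt C = 0 \<and> (A \<subseteq> range Inr \<and> C = f1 ` A \<or> A \<subseteq> range Inl \<and> C = f3 ` A)"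
proof -
  have ne: "A \<noteq> {}" using block_nonempty A by simp
  have d13: "f1 ` A \<inter> f3 ` A = {}" using f_relations(8) by blast
  then have n13: "\<not> f1 ` A \<subseteq> f3 ` A" "\<not> f3 ` A \<subseteq> f1 ` A" using ne by blast+
  have card_f: "card (f1 ` A) = card A" "card (f2 ` A) = card A" "card (f3 ` A) = card A"
    using inj_f by (simp_all add: card_image inj_on_subset)
  have "proj ` C \<subseteq> A" using proj_zigzag_block[OF C] by simp
  note wt = zigzag_weight[OF A this]
  consider (lower) "A \<subseteq> range Inr" | (upper) "A \<subseteq> range Inl"
    | (through) "\<not> A \<subseteq> range Inl" "\<not> A \<subseteq> range Inr" by blast
  then show ?thesis
  proof cases
    case lower
    have M1: "f1 ` A \<subseteq> M" using lower f_relations(1) by blast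
    have "f3 x \<notin> M" if "x \<in> A" for x
      using lower that f_relations(3)[of x] by auto
    then have M3: "f3 ` A \<inter> M = {}" by blast
    have f14: "f14 ` A = f3 ` A" using lower f_relations(7) by (auto intro!: image_cong)
    consider "C = f1 ` A" | "C = f3 ` A" using C lower by (auto simp: zigzag_blocks_def)
    then show ?thesis
    proof cases
      case 1
      have "C \<inter> M = f1 ` A" using M1 1 by blast
      then show ?thesis using wt 1 n13 lower M1 by (simp add: lower_eq card_f)
    next
      case 2
      have "C \<inter> M = {}" "C - M = f14 ` A" using M3 2 f14 by blast+
      then show ?thesis using wt 2 n13 lower by (simp add: lower_eq card_f)
    qed
  next
    case upper
    have M3: "f3 ` A \<subseteq> M" using upper f_relations(3) by blast
    have "f1 x \<notin> M" if "x \<in> A" for x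
      using upper that f_relations(1)[of x] by auto
    then have M1: "f1 ` A \<inter> M = {}" by blast
    have f14: "f14 ` A = f1 ` A" using upper f_relations(6) by (auto intro!: image_cong)
    consider "C = f1 ` A" | "C = f3 ` A" using C upper by (auto simp: zigzag_blocks_def)
    then show ?thesis
    proof cases
      case 1
      have "C \<inter> M = {}" "C - M = f14 ` A" using M1 1 f14 by blast+
      then show ?thesis using wt 1 n13 upper by (simp add: upper_eq card_f)
    next
      case 2
      have "C \<inter> M = f3 ` A" using M3 2 by blast
      then show ?thesis using wt 2 n13 upper M3 by (simp add: upper_eq card_f)
    qed
  next
    case through
    then have C': "C = f1 ` A \<union> f2 ` A \<union> f3 ` A" using C by (simp add: zigzag_blocks_def)
    have cases: "f1 x \<in> M \<and> f1 x = f2 x \<and> f3 x \<notin> M \<and> f14 x = f3 x \<or>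
        f3 x \<in> M \<and> f3 x = f2 x \<and> f1 x \<notin> M \<and> f14 x = f1 x" for x
      by (cases x) (simp_all add: f_eval middle2_def middle3_def image_iff)
    have "C \<inter> M = f2 ` A"
    proof
      show "C \<inter> M \<subseteq> f2 ` A" unfolding C' using cases by blast
      show "f2 ` A \<subseteq> C \<inter> M" unfolding C' using f_relations(2) by blast
    qed
    moreover have "C - M = f14 ` A"
    proof
      show "C - M \<subseteq> f14 ` A"
      proof
        fix y assume y: "y \<in> C - M"
        then obtain x where x: "x \<in> A" "y = f1 x \<or> y = f2 x \<or> y = f3 x" unfolding C' by blast
        then have "y = f14 x" using y cases[of x] by auto
        then show "y \<in> f14 ` A" using x by blast
      qed
      show "f14 ` A \<subseteq> C - M"
      proof
        fix y assume "y \<in> f14 ` A"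
        then obtain x where "x \<in> A" "y = f14 x" by blast
        then show "y \<in> C - M" unfolding C' using cases[of x] by auto
      qed
    qed
    moreover have "f1 ` A \<subseteq> C" "f2 ` A \<subseteq> C" "f3 ` A \<subseteq> C" unfolding C' by blast+
    ultimately show ?thesis using wt by (simp add: card_f)
  qed
qed

private lemma zigzag_live_block:
  assumes A: "A \<in> \<alpha>"
  shows "\<exists>C \<in> zigzag_blocks A. C - M = f14 ` A"
proof -
  have "f14 x \<in> f1 ` A \<union> f3 ` A - M" if "x \<in> A" for x
    using that by (cases x) (auto simp: f_eval middle2_def middle3_def image_iff intro!: bexI[of _ x])
  moreover obtain x where "x \<in> A" using block_nonempty[OF A] by blast
  ultimately have "f14 x \<in> f1 ` A \<union> f3 ` A - M" by blast
  then obtain C where C: "C \<in> zigzag_blocks A" "f14 x \<in> C - M"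
    using zigzag_block_covers[OF A] by blast
  then show ?thesis using zigzag_block_cases[OF A C(1)] by blast
qed

private lemma dead_zigzag_blocks:
  "{C \<in> generated_partition pieces. C \<subseteq> M} =
    image f3 ` {A \<in> \<alpha>. A \<subseteq> range Inl} \<union> image f1 ` {A \<in> \<alpha>. A \<subseteq> range Inr}" (is "?D = ?U \<union> ?L")
proof
  show "?D \<subseteq> ?U \<union> ?L"
  proof
    fix C assume "C \<in> ?D"
    then obtain A where A: "A \<in> \<alpha>" "C \<in> zigzag_blocks A" "C - M = {}"
      unfolding generated_partition_zigzag by blast
    then have "C - M \<noteq> f14 ` A" using block_nonempty by auto
    then show "C \<in> ?U \<union> ?L" using zigzag_block_cases[OF A(1,2)] A(1) by blast
  qed
  have U: "f3 ` A \<in> zigzag_blocks A" "f3 ` A \<subseteq> M" if "A \<subseteq> range Inl" for A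
  proof -
    show "f3 ` A \<in> zigzag_blocks A" using that by (simp add: zigzag_blocks_def)
    show "f3 ` A \<subseteq> M" using that f_relations(3) by blast
  qed
  have L: "f1 ` A \<in> zigzag_blocks A" "f1 ` A \<subseteq> M" if "A \<subseteq> range Inr" for A
  proof -
    show "f1 ` A \<in> zigzag_blocks A" using that by (simp add: zigzag_blocks_def)
    show "f1 ` A \<subseteq> M" using that f_relations(1) by blast
  qed
  show "?U \<union> ?L \<subseteq> ?D"
    unfolding generated_partition_zigzag
  proof
    fix C assume "C \<in> ?U \<union> ?L"
    then obtain A where A: "A \<in> \<alpha>" "A \<subseteq> range Inl \<and> C = f3 ` A \<or> A \<subseteq> range Inr \<and> C = f1 ` A"
      by blast
    then have "C \<in> zigzag_blocks A \<and> C \<subseteq> M" using U[of A] L[of A] by (elim disjE conjE) simp_all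
    then show "C \<in> {C \<in> \<Union>A\<in>\<alpha>. zigzag_blocks A. C \<subseteq> M}" using A(1) by simp blast
  qed
qed

private lemma presents_regular:
  "presents f14 M (generated_partition pieces) wt (s + snd (snd (cob_star (\<alpha>, g, s))) + s) (\<alpha>, g, s)"
proof -
  let ?P = "generated_partition pieces" and ?s' = "snd (snd (cob_star (\<alpha>, g, s)))"
  have tr: "image f14 ` \<alpha> = trace M ?P"
  proof
    show "image f14 ` \<alpha> \<subseteq> trace M ?P"
    proof
      fix X assume "X \<in> image f14 ` \<alpha>"
      then obtain A where A: "A \<in> \<alpha>" "X = f14 ` A" by blast
      then have "X \<noteq> {}" using block_nonempty by simp
      moreover obtain C where "C \<in> ?P" "C - M = X"
        using zigzag_live_block[OF A(1)] A generated_partition_zigzag by blast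
      ultimately show "X \<in> trace M ?P" unfolding trace_def by blast
    qed
    show "trace M ?P \<subseteq> image f14 ` \<alpha>"
    proof
      fix X assume "X \<in> trace M ?P"
      then obtain A C where A: "A \<in> \<alpha>" "C \<in> zigzag_blocks A" "X = C - M" "X \<noteq> {}"
        unfolding trace_def generated_partition_zigzag by blast
      then show "X \<in> image f14 ` \<alpha>" using zigzag_block_cases[OF A(1,2)] by blast
    qed
  qed
  have "g A = wt C + 1" if AC: "A \<in> \<alpha>" "C \<in> ?P" "f14 ` A = C - M" for A C
  proof -
    obtain B where B: "B \<in> \<alpha>" "C \<in> zigzag_blocks B"
      using AC(2) unfolding generated_partition_zigzag by blast
    have "C - M \<noteq> {}" using AC block_nonempty by (metis image_is_empty)
    then have *: "C - M = f14 ` B" "wt C = g B - 1" using zigzag_block_cases[OF B] by blast+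
    then have "proj ` f14 ` A = proj ` f14 ` B" using AC(3) by simp
    then show ?thesis using *(2) by simp
  qed
  then have labels: "\<forall>A\<in>\<alpha>. \<forall>C\<in>?P. f14 ` A = C - M \<longrightarrow> g A = wt C + 1"
    by (intro ballI impI)
  have "Poly_Mapping.lookup s i = Poly_Mapping.lookup (s + ?s' + s) i +
      int (card {C \<in> ?P. C \<subseteq> M \<and> wt C + 1 = i})" for i
  proof -
    let ?U = "image f3 ` {A \<in> \<alpha>. A \<subseteq> range Inl}" and ?L = "image f1 ` {A \<in> \<alpha>. A \<subseteq> range Inr}"
    have wt: "wt C = 0" if C: "C \<in> ?P" "C \<subseteq> M" for C
    proof -
      obtain A where A: "A \<in> \<alpha>" "C \<in> zigzag_blocks A"
        using C(1) unfolding generated_partition_zigzag by blast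
      then have "C - M \<noteq> f14 ` A" using block_nonempty C(2) by (metis Diff_eq_empty_iff image_is_empty)
      then show ?thesis using zigzag_block_cases[OF A] by blast
    qed
    have fin: "finite \<alpha>" using cob_homD(2)[OF f] .
    have "?U \<inter> ?L = {}"
    proof -
      have "f3 ` A \<noteq> f1 ` B" if A: "A \<in> \<alpha>" for A B
      proof -
        obtain x where "x \<in> A" using block_nonempty[OF A] by blast
        then show ?thesis using f_relations(8)[of _ x] by (metis imageE imageI)
      qed
      then show ?thesis by blast
    qed
    then have "card {C \<in> ?P. C \<subseteq> M} = ub \<alpha> + lb \<alpha>"
      unfolding dead_zigzag_blocks ub_def lb_def using fin
      by (simp add: card_Un_disjoint card_image inj_on_image_sets[OF inj_f(1)] inj_on_image_sets[OF inj_f(3)])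
    moreover have "{C \<in> ?P. C \<subseteq> M \<and> wt C + 1 = i} = (if i = 1 then {C \<in> ?P. C \<subseteq> M} else {})"
    proof (cases "i = 1")
      case True
      have "C \<in> ?P \<and> C \<subseteq> M \<and> wt C + 1 = i \<longleftrightarrow> C \<in> ?P \<and> C \<subseteq> M" for C
        using wt[of C] True by linarith
      then show ?thesis by (simp only: True simp_thms if_True)
    next
      case False
      have "\<not> (C \<in> ?P \<and> C \<subseteq> M \<and> wt C + 1 = i)" for C using wt[of C] False by linarith
      then show ?thesis using False by (simp only: if_False Collect_empty_eq simp_thms)
    qed
    ultimately have "int (card {C \<in> ?P. C \<subseteq> M \<and> wt C + 1 = i}) =
        (if i = 1 then int (ub \<alpha>) + int (lb \<alpha>) else 0)" by (simp del: One_nat_def)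
    moreover have "Poly_Mapping.lookup ?s' i =
        - Poly_Mapping.lookup s i - (if i = 1 then int (ub \<alpha>) + int (lb \<alpha>) else 0)"
      by (simp add: cob_star_def lookup_update)
    moreover have "Poly_Mapping.lookup (s + ?s' + s) i =
        Poly_Mapping.lookup s i + Poly_Mapping.lookup ?s' i + Poly_Mapping.lookup s i"
      by (simp only: lookup_add)
    ultimately show ?thesis by linarith
  qed
  then have "\<forall>i. Poly_Mapping.lookup s i = Poly_Mapping.lookup (s + ?s' + s) i +
      int (card {C \<in> ?P. C \<subseteq> M \<and> wt C + 1 = i})" by (intro allI)
  with tr labels show ?thesis
    using cob_homD(5)[OF f] unfolding presents.simps by (intro conjI)
qed

lemma cob_comp_star_regular: "cob_comp (cob_comp (\<alpha>, g, s) (cob_star (\<alpha>, g, s))) (\<alpha>, g, s) = (\<alpha>, g, s)"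
proof -
  have star: "cob_star (\<alpha>, g, s) = (partition_star \<alpha>, g', snd (snd (cob_star (\<alpha>, g, s))))"
    by (simp add: cob_star_def)
  show ?thesis
    using presents_unique[OF inj_emb14 presents_left[OF f cob_star_in_hom[OF f] f refl star refl]
        presents_regular[unfolded f14_def]] .
qed

end

theorem proposition2p5: "weak_regular_involution cob_hom cob_comp cob_star"
proof
  show "\<exists>e \<in> cob_hom m m. (\<forall>n. \<forall>f \<in> cob_hom m n. cob_comp e f = f) \<and>
      (\<forall>n. \<forall>f \<in> cob_hom n m. cob_comp f e = f)" for m
    using cob_id_in_hom cob_id_left cob_id_right by blast
  show "cob_comp (cob_comp f (cob_star f)) f = f" if "f \<in> cob_hom m n" for f m n
    using cob_comp_star_regular that by (metis prod_cases3)
qed (fact cob_hom_unique cob_comp_in_hom cob_comp_assoc cob_star_in_hom cob_star_star)+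

end
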